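(* For any $n\ge1$ and $z,w\in\mathbb B^n$, $K_{Sz}(z,w)$ equals $$\frac{\Gamma(n)}{2\pi^n}\frac{(1-|w|^2)^n}{|1-\langle z,w\rangle|^{2n}}\sum_{i_1=0}^n\sum_{i_2,j_1=0}^{n-i_1}\frac{(-n)_{i_1+i_2}(-n)_{i_1+j_1}(n)_{i_2}(n)_{j_1}}{i_1!\,i_2!\,j_1!\,(n)_{i_1+i_2+j_1}}\,t_1^{i_1}t_2^{i_2}t_3^{j_1}\,{}_2F_1\!\left(i_2+n,j_1+n;i_1+i_2+j_1+n;t_4\right),$$ where $t_1=|z|^2$, $t_2=\frac{|z|^2-\langle w,z\rangle}{1-\langle w,z\rangle}$, $t_3=\overline{t_2}$, $t_4=1-\frac{(1-|z|^2)(1-|w|^2)}{|1-\langle z,w\rangle|^2}$.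
   Context: $\mathbb B^n$ is the open unit ball of $\mathbb C^n$, $\langle z,w\rangle=\sum_jz_j\bar w_j$, $d\sigma$ the unnormalized surface measure on $\partial\mathbb B^n$, $(a)_j$ the Pochhammer symbol and ${}_2F_1$ the Gauss hypergeometric function. $M$-harmonic functions are those annihilated by $\tilde\Delta=4(1-|z|^2)\sum_{j,k}(\delta_{jk}-z_j\bar z_k)\partial^2/\partial z_j\partial\bar z_k$. $K_{Sz}$ is the $M$-harmonic Szegő kernel, i.e. the reproducing kernel of the space of $M$-harmonic functions on $\mathbb B^n$ with radial boundary values in $L^2(\partial\mathbb B^n,d\sigma)$ (inner product of boundary values in $L^2(d\sigma)$), so that $f(x)=\int_{\partial\mathbb B^n}f(\zeta)K_{Sz}(x,\zeta)d\sigma(\zeta)$; equivalently $K_{Sz}(x,y)=\int_{\partial\mathbb B^n}P(x,\zeta)P(y,\zeta)d\sigma(\zeta)$ with $P(x,\zeta)=\frac{\Gamma(n)}{2\pi^n}\frac{(1-|x|^2)^n}{|1-\langle x,\zeta\rangle|^{2n}}$. *)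

theory Defs
  imports "HOL-Analysis.Analysis"
begin

definition cinner :: "complex ^ 'n \<Rightarrow> complex ^ 'n \<Rightarrow> complex" where
  "cinner z w = (\<Sum>j\<in>UNIV. z $ j * cnj (w $ j))"

text \<open>Unnormalized surface measure on the unit sphere of C^n (real dimension 2n):
  sigma(E) = 2n * Lebesgue volume of the cone {r zeta | 0 < r <= 1, zeta in E},
  realised as 2n times the push-forward of Lebesgue measure on the punctured unit ball
  under the radial projection x \<mapsto> x / |x|.\<close>
definition sphere_measure :: "(complex ^ 'n) measure" where
  "sphere_measure = scale_measure (ennreal (real (DIM(complex ^ 'n))))
     (distr (restrict_space lborel (ball 0 1 - {0})) borel sgn)"

definition poisson_ball :: "complex ^ 'n \<Rightarrow> complex ^ 'n \<Rightarrow> real" where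
  "poisson_ball x \<zeta> = Gamma (real CARD('n)) / (2 * pi ^ CARD('n)) *
     (1 - norm x ^ 2) ^ CARD('n) / cmod (1 - cinner x \<zeta>) ^ (2 * CARD('n))"

definition K_Sz :: "complex ^ 'n \<Rightarrow> complex ^ 'n \<Rightarrow> real" where
  "K_Sz x y = (\<integral>\<zeta>. poisson_ball x \<zeta> * poisson_ball y \<zeta> \<partial>(sphere_measure :: (complex ^ 'n) measure))"

definition hyp2F1 :: "real \<Rightarrow> real \<Rightarrow> real \<Rightarrow> real \<Rightarrow> real" where
  "hyp2F1 a b c x = (\<Sum>k. pochhammer a k * pochhammer b k / (pochhammer c k * fact k) * x ^ k)"

end

theory Submission
  imports Defs "HOL-Probability.Distributions" "HOL-Real_Asymp.Real_Asymp"
begin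

text \<open>
  Let \<open>\<phi>\<^sub>z\<close> be the involution of the ball exchanging \<open>0\<close> and \<open>z\<close>. Under \<open>\<zeta> = \<phi>\<^sub>z \<omega>\<close> the kernel becomes the
  integral of \<open>\<bar>1 - \<langle>z, \<omega>\<rangle>\<bar>\<^sup>2\<^sup>n / \<bar>1 - \<langle>\<phi>\<^sub>z w, \<omega>\<rangle>\<bar>\<^sup>2\<^sup>n\<close>; expanding the numerator by the binomial theorem and the
  denominator by the binomial series gives the triple sum, with a hypergeometric tail in each term.

  The change of variables is replaced by moments. The functions \<open>\<langle>\<phi>\<^sub>z x, \<phi>\<^sub>z \<zeta>\<rangle>\<close> are rational in \<open>\<zeta>\<close>, and the
  Poisson weight cancels their denominators in the generating function
  \<open>(1 - g)\<^sup>-\<^sup>n (1 - h)\<^sup>-\<^sup>n\<close>, so that it integrates, by the Szego kernel formula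
  \<open>\<integral> (a - \<langle>u, \<zeta>\<rangle>)\<^sup>-\<^sup>n (b - \<langle>\<zeta>, v\<rangle>)\<^sup>-\<^sup>n d\<sigma> = \<bar>S\<bar> (a b - \<langle>u, v\<rangle>)\<^sup>-\<^sup>n\<close>, to the same expression as on the
  untransformed sphere; comparing coefficients gives all mixed moments. The Szego formula itself follows from
  the moments of \<open>\<langle>a, \<zeta>\<rangle>\<^sup>k \<langle>\<zeta>, b\<rangle>\<^sup>l\<close>, which come from Gaussian integrals in polar coordinates.
\<close>

subsection \<open>Power series under the integral sign\<close>

text \<open>The exponent n makes the expansions close up: divided by the total area, the k-th moment
  on the sphere carries the factor k! / (n)_k, the reciprocal of the k-th coefficient of (1 -
  x)^(-n), so a double expansion collapses to a single series that is again of this form. The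
  transformed integral involves the two points \<phi>(0) = z and \<phi>(w), where \<phi> is the
  involution at z; the variables t1, t2, t3, t4 are their Hermitian products <z,z>, <\<phi>(w),z>,
  <z,\<phi>(w)>, <\<phi>(w),\<phi>(w)>. Hence moments are required that mix powers of two functions
  p, q and of their conjugates, while a generating function controls powers of one function only.
  Polarization bridges this: the one function is a pencil s p + t q with free coefficients, and
  coefficients of s are compared afterwards. The other obstacle is the surface measure, given as a
  radial projection of Lebesgue measure. Homogeneous integrands pass from Gaussian to ball to sphere
  by layer-cake identities, without a polar Jacobian.\<close>

lemma power_series_unique:
  fixes a b :: "nat \<Rightarrow> complex"
  assumes "0 < \<rho>"
    and a: "\<And>x. norm x < \<rho> \<Longrightarrow> (\<lambda>k. a k * x ^ k) sums F x"
    and b: "\<And>x. norm x < \<rho> \<Longrightarrow> (\<lambda>k. b k * x ^ k) sums F x"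
  shows "a = b"
proof -
  have radius: "fps_conv_radius (Abs_fps c) > 0"
    if "\<And>x. norm x < \<rho> \<Longrightarrow> (\<lambda>k. c k * x ^ k) sums F x" for c :: "nat \<Rightarrow> complex"
  proof -
    have "summable (\<lambda>k. c k * complex_of_real (\<rho>/2) ^ k)"
      using that[of "complex_of_real (\<rho>/2)"] \<open>0 < \<rho>\<close> by (auto simp: sums_iff)
    then have "conv_radius c \<ge> norm (complex_of_real (\<rho>/2))"
      by (rule conv_radius_geI)
    moreover have "ereal (norm (complex_of_real (\<rho>/2))) > 0" using \<open>0 < \<rho>\<close> by simp
    ultimately have "conv_radius c > 0" by (rule less_le_trans[rotated])
    then show ?thesis by (simp add: fps_conv_radius_def)
  qed
  have "eventually (\<lambda>x. norm x < \<rho>) (nhds (0::complex))"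
    using eventually_nhds_ball[OF \<open>0 < \<rho>\<close>, of "0::complex"] by (auto simp: dist_norm)
  then have "eventually (\<lambda>x. eval_fps (Abs_fps a) x = eval_fps (Abs_fps b) x) (nhds 0)"
    by eventually_elim (use a b in \<open>auto simp: eval_fps_def sums_iff\<close>)
  with radius a b have "Abs_fps a = Abs_fps b" by (intro eval_fps_eqD) auto
  then show ?thesis by (metis fps_nth_Abs_fps ext)
qed

text \<open>Dominated convergence for the partial sums: \<open>W\<close> bounds the weight times the
  full series of absolute values, hence all partial sums at once.\<close>

lemma integral_power_series:
  fixes f G :: "'a \<Rightarrow> complex" and c :: "nat \<Rightarrow> complex"
  assumes [measurable]: "f \<in> borel_measurable M" "G \<in> borel_measurable M"
    and W: "integrable M W"
    and summ: "AE x in M. summable (\<lambda>k. norm (c k) * norm (f x) ^ k)"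
    and bound: "AE x in M. norm (G x) * (\<Sum>k. norm (c k) * norm (f x) ^ k) \<le> W x"
  shows "(\<lambda>k. c k * (\<integral>x. G x * f x ^ k \<partial>M)) sums (\<integral>x. G x * (\<Sum>k. c k * f x ^ k) \<partial>M)"
proof -
  have partial: "AE x in M. norm (G x * (\<Sum>k<N. c k * f x ^ k)) \<le> W x" for N
    using summ bound
  proof eventually_elim
    case (elim x)
    have "norm (\<Sum>k<N. c k * f x ^ k) \<le> (\<Sum>k<N. norm (c k) * norm (f x) ^ k)"
      by (rule sum_norm_le) (simp add: norm_mult norm_power)
    also have "\<dots> \<le> (\<Sum>k. norm (c k) * norm (f x) ^ k)"
      by (rule sum_le_suminf) (use elim in auto)
    finally show ?case
      using elim(2) by (simp add: norm_mult) (meson mult_left_mono norm_ge_zero order_trans)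
  qed
  have lim: "AE x in M. (\<lambda>N. G x * (\<Sum>k<N. c k * f x ^ k)) \<longlonglongrightarrow> G x * (\<Sum>k. c k * f x ^ k)"
    using summ
  proof eventually_elim
    case (elim x)
    have "summable (\<lambda>k. c k * f x ^ k)"
      by (rule summable_norm_cancel) (use elim in \<open>simp add: norm_mult norm_power\<close>)
    then show ?case by (intro tendsto_mult tendsto_const summable_LIMSEQ)
  qed
  have conv: "(\<lambda>N. \<integral>x. G x * (\<Sum>k<N. c k * f x ^ k) \<partial>M) \<longlonglongrightarrow> (\<integral>x. G x * (\<Sum>k. c k * f x ^ k) \<partial>M)"
    by (rule integral_dominated_convergence[OF _ _ W lim partial]) simp_all
  have int: "integrable M (\<lambda>x. c k * (G x * f x ^ k))" for k
  proof (rule Bochner_Integration.integrable_bound[OF W])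
    show "AE x in M. norm (c k * (G x * f x ^ k)) \<le> norm (W x)"
      using summ bound
    proof eventually_elim
      case (elim x)
      have "norm (c k) * norm (f x) ^ k \<le> (\<Sum>k. norm (c k) * norm (f x) ^ k)"
        using sum_le_suminf[OF elim(1), of "{k}"] by simp
      then have "norm (G x) * (norm (c k) * norm (f x) ^ k) \<le> W x"
        using elim(2) by (meson mult_left_mono norm_ge_zero order_trans)
      then show ?case by (simp add: norm_mult norm_power mult_ac)
    qed
  qed simp
  have "(\<integral>x. G x * (\<Sum>k<N. c k * f x ^ k) \<partial>M) = (\<Sum>k<N. c k * (\<integral>x. G x * f x ^ k \<partial>M))" for N
  proof -
    have "(\<integral>x. G x * (\<Sum>k<N. c k * f x ^ k) \<partial>M) = (\<integral>x. (\<Sum>k<N. c k * (G x * f x ^ k)) \<partial>M)"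
      by (simp add: sum_distrib_left mult_ac)
    also have "\<dots> = (\<Sum>k<N. \<integral>x. c k * (G x * f x ^ k) \<partial>M)"
      by (rule Bochner_Integration.integral_sum) (rule int)
    finally show ?thesis by simp
  qed
  with conv show ?thesis by (simp add: sums_def)
qed

text \<open>A generating function in which s and t enter only through s * t has no off-diagonal
  coefficients. Coefficients are compared in one variable at a time, and the same majorant justifies
  both exchanges of sum and integral. The sequence \<open>c\<close> stays general because the
  exponential series serves the Gaussian integrals and the negative binomial series serves the
  sphere.\<close>

lemma moments_from_generating_function:
  fixes f g w :: "'a \<Rightarrow> complex" and c d :: "nat \<Rightarrow> complex"
  assumes [measurable]: "f \<in> borel_measurable M" "g \<in> borel_measurable M" "w \<in> borel_measurable M"
    and W: "integrable M (\<lambda>x. norm (w x) * (\<Sum>k. norm (c k) * norm (f x) ^ k) * (\<Sum>k. norm (c k) * norm (g x) ^ k))"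
    and sf: "AE x in M. summable (\<lambda>k. norm (c k) * norm (f x) ^ k)"
    and sg: "AE x in M. summable (\<lambda>k. norm (c k) * norm (g x) ^ k)"
    and gen: "\<And>s t. norm s < 1 \<Longrightarrow> norm t < 1 \<Longrightarrow>
      (\<lambda>k. d k * (s * t) ^ k) sums
        (\<integral>x. w x * (\<Sum>k. c k * (s * f x) ^ k) * (\<Sum>k. c k * (t * g x) ^ k) \<partial>M)"
  shows "c k * c l * (\<integral>x. w x * f x ^ k * g x ^ l \<partial>M) = (if k = l then d k else 0)"
proof -
  let ?W = "\<lambda>x. norm (w x) * (\<Sum>k. norm (c k) * norm (f x) ^ k) * (\<Sum>k. norm (c k) * norm (g x) ^ k)"
  define T where "T t x = (\<Sum>k. c k * (t * g x) ^ k)" for t x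
  have [measurable]: "T t \<in> borel_measurable M" for t unfolding T_def by measurable
  have T_bound: "AE x in M. norm (T t x) \<le> (\<Sum>k. norm (c k) * norm (g x) ^ k)" if "norm t < 1" for t
    using sg
  proof eventually_elim
    case (elim x)
    have le: "norm (c k * (t * g x) ^ k) \<le> norm (c k) * norm (g x) ^ k" for k
      using that by (simp add: norm_mult norm_power mult_left_mono power_mono mult_left_le_one_le)
    have "summable (\<lambda>k. norm (c k * (t * g x) ^ k))"
      by (rule summable_comparison_test[OF _ elim]) (use le in auto)
    then have "norm (T t x) \<le> (\<Sum>k. norm (c k * (t * g x) ^ k))"
      unfolding T_def by (rule summable_norm)
    also have "\<dots> \<le> (\<Sum>k. norm (c k) * norm (g x) ^ k)"
      by (rule suminf_le[OF le]) fact+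
    finally show ?case .
  qed
  have step1: "(\<lambda>k. c k * (\<integral>x. w x * T t x * f x ^ k \<partial>M)) = (\<lambda>k. d k * t ^ k)" if t: "norm t < 1" for t
  proof (rule power_series_unique[of 1])
    fix s :: complex assume s: "norm s < 1"
    have "(\<lambda>k. c k * (\<integral>x. w x * T t x * (s * f x) ^ k \<partial>M)) sums
        (\<integral>x. w x * T t x * (\<Sum>k. c k * (s * f x) ^ k) \<partial>M)"
    proof (rule integral_power_series[OF _ _ W])
      have le: "norm (c k) * norm (s * f x) ^ k \<le> norm (c k) * norm (f x) ^ k" for k x
        using s by (simp add: norm_mult norm_power mult_left_mono power_mono mult_left_le_one_le)
      show "AE x in M. summable (\<lambda>k. norm (c k) * norm (s * f x) ^ k)"
        using sf
      proof eventually_elim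
        case (elim x)
        show ?case by (rule summable_comparison_test[OF _ elim]) (use le in auto)
      qed
      then show "AE x in M. norm (w x * T t x) * (\<Sum>k. norm (c k) * norm (s * f x) ^ k) \<le> ?W x"
        using sf T_bound[OF t]
      proof eventually_elim
        case (elim x)
        have "(\<Sum>k. norm (c k) * norm (s * f x) ^ k) \<le> (\<Sum>k. norm (c k) * norm (f x) ^ k)"
          by (rule suminf_le[OF le]) (use elim in auto)
        moreover have "0 \<le> (\<Sum>k. norm (c k) * norm (s * f x) ^ k)"
          by (rule suminf_nonneg) (use elim in auto)
        ultimately have "norm (T t x) * (\<Sum>k. norm (c k) * norm (s * f x) ^ k)
            \<le> (\<Sum>k. norm (c k) * norm (g x) ^ k) * (\<Sum>k. norm (c k) * norm (f x) ^ k)"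
          using elim(3) by (intro mult_mono) (auto intro: order_trans[OF norm_ge_zero])
        then have "norm (w x) * (norm (T t x) * (\<Sum>k. norm (c k) * norm (s * f x) ^ k))
            \<le> norm (w x) * ((\<Sum>k. norm (c k) * norm (g x) ^ k) * (\<Sum>k. norm (c k) * norm (f x) ^ k))"
          by (rule mult_left_mono) simp
        then show ?case by (simp add: norm_mult mult_ac)
      qed
    qed simp_all
    also have "(\<lambda>k. c k * (\<integral>x. w x * T t x * (s * f x) ^ k \<partial>M))
        = (\<lambda>k. c k * (\<integral>x. w x * T t x * f x ^ k \<partial>M) * s ^ k)"
    proof
      fix k
      have "(\<integral>x. w x * T t x * (s * f x) ^ k \<partial>M) = (\<integral>x. s ^ k * (w x * T t x * f x ^ k) \<partial>M)"
        by (simp add: power_mult_distrib mult_ac)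
      then show "c k * (\<integral>x. w x * T t x * (s * f x) ^ k \<partial>M) = c k * (\<integral>x. w x * T t x * f x ^ k \<partial>M) * s ^ k"
        by simp
    qed
    finally show "(\<lambda>k. c k * (\<integral>x. w x * T t x * f x ^ k \<partial>M) * s ^ k) sums
        (\<integral>x. w x * T t x * (\<Sum>k. c k * (s * f x) ^ k) \<partial>M)" .
    have "(\<integral>x. w x * T t x * (\<Sum>k. c k * (s * f x) ^ k) \<partial>M)
        = (\<integral>x. w x * (\<Sum>k. c k * (s * f x) ^ k) * (\<Sum>k. c k * (t * g x) ^ k) \<partial>M)"
      by (simp add: T_def mult_ac)
    then show "(\<lambda>k. d k * t ^ k * s ^ k) sums (\<integral>x. w x * T t x * (\<Sum>k. c k * (s * f x) ^ k) \<partial>M)"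
      using gen[OF s t] by (simp add: power_mult_distrib mult_ac)
  qed simp
  \<comment> \<open>For fixed k the identity \<open>step1\<close> is now read as a power series in t
    whose sum is the single monomial d k * t ^ k.\<close>
  have "(\<lambda>l. c l * (c k * (\<integral>x. w x * f x ^ k * g x ^ l \<partial>M))) = (\<lambda>l. if l = k then d k else 0)"
  proof (rule power_series_unique[of 1])
    fix t :: complex assume t: "norm t < 1"
    have "(\<lambda>l. c l * (\<integral>x. c k * (w x * f x ^ k) * (t * g x) ^ l \<partial>M)) sums
        (\<integral>x. c k * (w x * f x ^ k) * (\<Sum>l. c l * (t * g x) ^ l) \<partial>M)"
    proof (rule integral_power_series[OF _ _ W])
      have le: "norm (c k) * norm (t * g x) ^ k \<le> norm (c k) * norm (g x) ^ k" for k x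
        using t by (simp add: norm_mult norm_power mult_left_mono power_mono mult_left_le_one_le)
      show "AE x in M. summable (\<lambda>l. norm (c l) * norm (t * g x) ^ l)"
        using sg
      proof eventually_elim
        case (elim x)
        show ?case by (rule summable_comparison_test[OF _ elim]) (use le in auto)
      qed
      then show "AE x in M. norm (c k * (w x * f x ^ k)) * (\<Sum>k. norm (c k) * norm (t * g x) ^ k) \<le> ?W x"
        using sf sg
      proof eventually_elim
        case (elim x)
        have "(\<Sum>k. norm (c k) * norm (t * g x) ^ k) \<le> (\<Sum>k. norm (c k) * norm (g x) ^ k)"
          by (rule suminf_le[OF le]) (use elim in auto)
        moreover have "0 \<le> (\<Sum>k. norm (c k) * norm (t * g x) ^ k)"
          by (rule suminf_nonneg) (use elim in auto)
        moreover have "norm (c k) * norm (f x) ^ k \<le> (\<Sum>k. norm (c k) * norm (f x) ^ k)"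
          using sum_le_suminf[OF elim(2), of "{k}"] by simp
        ultimately have "(norm (c k) * norm (f x) ^ k) * (\<Sum>k. norm (c k) * norm (t * g x) ^ k)
            \<le> (\<Sum>k. norm (c k) * norm (f x) ^ k) * (\<Sum>k. norm (c k) * norm (g x) ^ k)"
          by (intro mult_mono) (auto intro!: suminf_nonneg elim)
        then have "norm (w x) * ((norm (c k) * norm (f x) ^ k) * (\<Sum>k. norm (c k) * norm (t * g x) ^ k))
            \<le> norm (w x) * ((\<Sum>k. norm (c k) * norm (f x) ^ k) * (\<Sum>k. norm (c k) * norm (g x) ^ k))"
          by (rule mult_left_mono) simp
        then show ?case by (simp add: norm_mult norm_power mult_ac)
      qed
    qed simp_all
    also have "(\<lambda>l. c l * (\<integral>x. c k * (w x * f x ^ k) * (t * g x) ^ l \<partial>M))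
        = (\<lambda>l. c l * (c k * (\<integral>x. w x * f x ^ k * g x ^ l \<partial>M)) * t ^ l)"
    proof
      fix l
      have "(\<integral>x. c k * (w x * f x ^ k) * (t * g x) ^ l \<partial>M) = (\<integral>x. (c k * t ^ l) * (w x * f x ^ k * g x ^ l) \<partial>M)"
        by (simp add: power_mult_distrib mult_ac)
      then show "c l * (\<integral>x. c k * (w x * f x ^ k) * (t * g x) ^ l \<partial>M)
          = c l * (c k * (\<integral>x. w x * f x ^ k * g x ^ l \<partial>M)) * t ^ l"
        by simp
    qed
    also have "(\<integral>x. c k * (w x * f x ^ k) * (\<Sum>l. c l * (t * g x) ^ l) \<partial>M)
        = (\<integral>x. c k * (w x * T t x * f x ^ k) \<partial>M)"
      by (simp add: T_def mult_ac)
    also have "\<dots> = d k * t ^ k"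
      using fun_cong[OF step1[OF t], of k] by simp
    finally show "(\<lambda>l. c l * (c k * (\<integral>x. w x * f x ^ k * g x ^ l \<partial>M)) * t ^ l) sums (d k * t ^ k)" .
    show "(\<lambda>l. (if l = k then d k else 0) * t ^ l) sums (d k * t ^ k)"
      using sums_single[of k "\<lambda>l. d l * t ^ l"] by (simp add: if_distrib if_distribR cong: if_cong)
  qed simp
  from fun_cong[OF this, of l] show ?thesis by (auto simp: mult_ac)
qed

subsection \<open>Gaussian integrals\<close>

lemma exp_power_series: "(\<lambda>k. inverse (fact k) * x ^ k) sums exp (x :: 'a :: {real_normed_field, banach})"
  using exp_converges[of x] by (simp add: scaleR_conv_of_real)

lemmas exp_suminf = exp_power_series[THEN sums_unique, symmetric]

text \<open>For complex \<open>c\<close> completing the square would shift the line of integration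
  into the complex plane. Instead the exponential of c u is expanded: odd moments vanish, and the
  even ones reassemble to \<open>exp (c\<^sup>2 / 4)\<close>.\<close>

lemma
  fixes c :: complex
  shows integrable_gaussian: "integrable lborel (\<lambda>u. exp (c * complex_of_real u - complex_of_real (u\<^sup>2)))"
    and integrable_gaussian_abs: "integrable lborel (\<lambda>u::real. exp (r * \<bar>u\<bar> - u\<^sup>2))"
    and integral_gaussian: "(\<integral>u. exp (c * complex_of_real u - complex_of_real (u\<^sup>2)) \<partial>lborel) = sqrt pi * exp (c\<^sup>2 / 4)"
proof -
  have gauss: "integrable lborel (\<lambda>u::real. exp (- u\<^sup>2))"
    using has_bochner_integral_even_function[OF gaussian_moment_0]
    by (auto simp: has_bochner_integral_iff)
  \<comment> \<open>Either sign of u is covered by the sum of the exponentials with r and -r; each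
    of them is a translated Gaussian after completing the square.\<close>
  have abs: "integrable lborel (\<lambda>u::real. exp (r * \<bar>u\<bar> - u\<^sup>2))" for r :: real
  proof (rule Bochner_Integration.integrable_bound)
    have e: "exp (r * u - u\<^sup>2) = exp (r\<^sup>2/4) * exp (-((- (r/2) + 1 * u)\<^sup>2))" for u r :: real
      by (simp add: exp_add[symmetric] power2_eq_square field_simps)
    have "integrable lborel (\<lambda>u::real. exp (r\<^sup>2/4) * exp (-((- (r/2) + 1 * u)\<^sup>2)))" for r :: real
      by (intro integrable_mult_right lborel_integrable_real_affine[OF gauss]) simp
    then show "integrable lborel (\<lambda>u::real. exp (r * u - u\<^sup>2) + exp ((- r) * u - u\<^sup>2))"
      unfolding e by (intro Bochner_Integration.integrable_add)
    show "AE u in lborel. norm (exp (r * \<bar>u\<bar> - u\<^sup>2)) \<le> norm (exp (r * u - u\<^sup>2) + exp ((- r) * u - u\<^sup>2))"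
    proof (rule AE_I2)
      fix u :: real
      have "norm (exp (r * u - u\<^sup>2) + exp ((- r) * u - u\<^sup>2)) = exp (r * u - u\<^sup>2) + exp ((- r) * u - u\<^sup>2)"
        unfolding real_norm_def by (intro abs_of_nonneg add_nonneg_nonneg) simp_all
      then show "norm (exp (r * \<bar>u\<bar> - u\<^sup>2)) \<le> norm (exp (r * u - u\<^sup>2) + exp ((- r) * u - u\<^sup>2))"
        by (cases "u < 0") simp_all
    qed
  qed simp
  show "integrable lborel (\<lambda>u::real. exp (r * \<bar>u\<bar> - u\<^sup>2))" by (rule abs)
  show "integrable lborel (\<lambda>u. exp (c * complex_of_real u - complex_of_real (u\<^sup>2)))"
  proof (rule Bochner_Integration.integrable_bound[OF abs[of "norm c"]])
    have "Re c * u \<le> norm c * \<bar>u\<bar>" for u :: real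
    proof -
      have "Re c * u \<le> \<bar>Re c\<bar> * \<bar>u\<bar>" by (metis abs_ge_self abs_mult)
      also have "\<dots> \<le> norm c * \<bar>u\<bar>" by (intro mult_right_mono abs_Re_le_cmod) simp
      finally show ?thesis .
    qed
    then show "AE u in lborel. norm (exp (c * complex_of_real u - complex_of_real (u\<^sup>2))) \<le> norm (exp (cmod c * \<bar>u\<bar> - u\<^sup>2))"
      by (auto simp: power2_eq_square)
  qed simp
  define m where "m k = (\<integral>u. exp (-u\<^sup>2) * u ^ k \<partial>lborel :: real)" for k :: nat
  have even: "m (2*k) = sqrt pi * (fact (2 * k) / (2 ^ (2 * k) * fact k))" for k
    using has_bochner_integral_even_function[OF gaussian_moment_even_pos[of k]]
    by (simp add: m_def has_bochner_integral_iff)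
  have odd: "m (2*k+1) = 0" for k
    using has_bochner_integral_odd_function[OF gaussian_moment_odd_pos[of k]]
    unfolding m_def by (simp add: has_bochner_integral_iff)
  have cm: "(\<integral>u. complex_of_real (exp (-u\<^sup>2)) * (c * complex_of_real u) ^ k \<partial>lborel) = c ^ k * m k" for k
  proof -
    have "(\<integral>u. complex_of_real (exp (-u\<^sup>2)) * (c * complex_of_real u) ^ k \<partial>lborel)
        = (\<integral>u. c ^ k * complex_of_real (exp (-u\<^sup>2) * u ^ k) \<partial>lborel)"
      by (simp add: power_mult_distrib mult_ac)
    then show ?thesis by (simp add: m_def flip: of_real_power of_real_mult)
  qed
  have "(\<lambda>k. inverse (fact k) * (\<integral>u. complex_of_real (exp (-u\<^sup>2)) * (c * complex_of_real u) ^ k \<partial>lborel)) sums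
     (\<integral>u. complex_of_real (exp (-u\<^sup>2)) * (\<Sum>k. inverse (fact k) * (c * complex_of_real u) ^ k) \<partial>lborel)"
  proof (rule integral_power_series[OF _ _ abs[of "norm c"]])
    have s: "(\<lambda>k. norm (inverse (fact k) :: complex) * norm (c * complex_of_real u) ^ k) sums exp (norm c * \<bar>u\<bar>)" for u
      using exp_converges[of "norm c * \<bar>u\<bar>"] by (simp add: norm_mult norm_inverse)
    show "AE x in lborel. summable (\<lambda>k. norm (inverse (fact k) :: complex) * norm (c * complex_of_real x) ^ k)"
      using s by (auto simp: sums_iff)
    show "AE x in lborel. norm (complex_of_real (exp (-x\<^sup>2))) * (\<Sum>k. norm (inverse (fact k) :: complex) * norm (c * complex_of_real x) ^ k)
        \<le> exp (norm c * \<bar>x\<bar> - x\<^sup>2)"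
      unfolding s[THEN sums_unique, symmetric] by (auto simp: exp_add[symmetric])
  qed simp_all
  also have "(\<integral>u. complex_of_real (exp (-u\<^sup>2)) * (\<Sum>k. inverse (fact k) * (c * complex_of_real u) ^ k) \<partial>lborel)
     = (\<integral>u. exp (c * complex_of_real u - complex_of_real (u\<^sup>2)) \<partial>lborel)"
    unfolding exp_suminf
    by (intro Bochner_Integration.integral_cong) (simp_all add: exp_add[symmetric] flip: exp_of_real)
  finally have full: "(\<lambda>k. inverse (fact k) * (c ^ k * m k)) sums (\<integral>u. exp (c * complex_of_real u - complex_of_real (u\<^sup>2)) \<partial>lborel)"
    unfolding cm .
  have "(\<lambda>k. inverse (fact (2*k)) * (c ^ (2*k) * m (2*k))) sums (\<integral>u. exp (c * complex_of_real u - complex_of_real (u\<^sup>2)) \<partial>lborel)"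
  proof (subst sums_mono_reindex[of "\<lambda>k. 2 * k" "\<lambda>k. inverse (fact k) * (c ^ k * m k)"])
    show "strict_mono (\<lambda>k. 2 * k :: nat)" by (auto simp: strict_mono_def)
    show "inverse (fact n) * (c ^ n * complex_of_real (m n)) = 0" if "n \<notin> range (\<lambda>k. 2 * k)" for n :: nat
    proof -
      have "odd n" using that by (auto simp: dvd_def)
      then obtain j where "n = 2 * j + 1" by (rule oddE)
      then show ?thesis using odd[of j] by simp
    qed
  qed (rule full)
  also have "(\<lambda>k. inverse (fact (2*k)) * (c ^ (2*k) * m (2*k))) = (\<lambda>k. sqrt pi * ((c\<^sup>2/4) ^ k /\<^sub>R fact k))"
  proof
    fix k
    show "inverse (fact (2*k)) * (c ^ (2*k) * m (2*k)) = sqrt pi * ((c\<^sup>2/4) ^ k /\<^sub>R fact k)"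
      unfolding even by (simp add: scaleR_conv_of_real power_mult power_divide divide_simps)
  qed
  finally have "(\<lambda>k. sqrt pi * ((c\<^sup>2/4) ^ k /\<^sub>R fact k)) sums (\<integral>u. exp (c * complex_of_real u - complex_of_real (u\<^sup>2)) \<partial>lborel)" .
  moreover have "(\<lambda>k. sqrt pi * ((c\<^sup>2/4) ^ k /\<^sub>R fact k)) sums (sqrt pi * exp (c\<^sup>2/4))"
    by (intro sums_mult exp_converges)
  ultimately show "(\<integral>u. exp (c * complex_of_real u - complex_of_real (u\<^sup>2)) \<partial>lborel) = sqrt pi * exp (c\<^sup>2 / 4)"
    by (rule sums_unique2)
qed

section \<open>Gaussian integrals in several variables\<close>

lemma
  fixes f :: "'a::euclidean_space \<Rightarrow> real \<Rightarrow> 'b::{real_normed_field,banach,second_countable_topology}"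
  assumes int: "\<And>b. b \<in> Basis \<Longrightarrow> integrable lborel (f b)"
  shows integrable_lborel_prod: "integrable lborel (\<lambda>x::'a. \<Prod>b\<in>Basis. f b (x \<bullet> b))"
    and integral_lborel_prod: "(\<integral>x. (\<Prod>b\<in>Basis. f b (x \<bullet> b)) \<partial>lborel) = (\<Prod>b\<in>Basis. \<integral>u. f b u \<partial>lborel)"
proof -
  interpret product_sigma_finite "\<lambda>_::'a. lborel :: real measure" ..
  have [measurable]: "f b \<in> borel_measurable borel" if "b \<in> Basis" for b
    using int[OF that] by simp
  have prod_meas: "(\<lambda>x::'a. \<Prod>b\<in>Basis. f b (x \<bullet> b)) \<in> borel_measurable borel"
    by measurable
  have coord: "(\<Prod>b\<in>Basis. f b ((\<Sum>b\<in>Basis. y b *\<^sub>R b) \<bullet> b)) = (\<Prod>b\<in>Basis. f b (y b))" for y :: "'a \<Rightarrow> real"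
    by (intro prod.cong) (auto simp: inner_sum_left inner_Basis if_distrib cong: if_cong)
  show "integrable lborel (\<lambda>x::'a. \<Prod>b\<in>Basis. f b (x \<bullet> b))"
    by (subst lborel_eq, subst integrable_distr_eq)
      (use prod_meas in \<open>auto simp: coord intro!: product_integrable_prod int\<close>)
  show "(\<integral>x. (\<Prod>b\<in>Basis. f b (x \<bullet> b)) \<partial>lborel) = (\<Prod>b\<in>Basis. \<integral>u. f b u \<partial>lborel)"
    by (subst lborel_eq, subst integral_distr)
      (use prod_meas in \<open>auto simp: coord intro!: product_integral_prod int\<close>)
qed

lemma norm_power2_eq_sum_Basis: "(norm x)\<^sup>2 = (\<Sum>b\<in>Basis. (x \<bullet> b)\<^sup>2)" for x :: "'a::euclidean_space"
  by (simp add: norm_eq_sqrt_inner euclidean_inner[of x x] power2_eq_square sum_nonneg)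

text \<open>The sum of the absolute coordinates dominates the norm and, unlike the norm, makes the
  exponential factorize over the coordinates; it serves as majorant below.\<close>

lemma integrable_gaussian_sum_abs:
  "integrable lborel (\<lambda>x::'a::euclidean_space. exp (r * (\<Sum>b\<in>Basis. \<bar>x \<bullet> b\<bar>) - (norm x)\<^sup>2))"
proof -
  have "exp (r * (\<Sum>b\<in>Basis. \<bar>x \<bullet> b\<bar>) - (norm x)\<^sup>2) = (\<Prod>b\<in>Basis. exp (r * \<bar>x \<bullet> b\<bar> - (x \<bullet> b)\<^sup>2))" for x :: 'a
    by (simp add: norm_power2_eq_sum_Basis exp_sum[symmetric] sum_subtractf sum_distrib_left)
  then show ?thesis
    using integrable_lborel_prod[where 'a='a and f="\<lambda>_ u. exp (r * \<bar>u\<bar> - u\<^sup>2)"] integrable_gaussian_abs by simp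
qed

text \<open>Real linearity is the right generality, since \<open>L\<close> will be the sum of a
  complex linear and an antilinear form. The squares on the right are complex squares, not squared
  moduli, which is what permits cancellation between basis vectors.\<close>

lemma integral_gaussian_linear:
  fixes L :: "'a::euclidean_space \<Rightarrow> complex"
  assumes "linear L"
  shows "(\<integral>x. exp (L x - complex_of_real ((norm x)\<^sup>2)) \<partial>lborel) = complex_of_real (sqrt pi ^ DIM('a)) * exp ((\<Sum>b\<in>Basis. (L b)\<^sup>2) / 4)"
proof -
  have L: "L x = (\<Sum>b\<in>Basis. L b * complex_of_real (x \<bullet> b))" for x
  proof -
    have "L x = L (\<Sum>b\<in>Basis. (x \<bullet> b) *\<^sub>R b)" by (simp add: euclidean_representation)
    also have "\<dots> = (\<Sum>b\<in>Basis. L b * complex_of_real (x \<bullet> b))"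
      by (simp add: linear_sum[OF assms] linear_scale[OF assms] scaleR_conv_of_real mult.commute)
    finally show ?thesis .
  qed
  have "exp (L x - complex_of_real ((norm x)\<^sup>2))
      = (\<Prod>b\<in>Basis. exp (L b * complex_of_real (x \<bullet> b) - complex_of_real ((x \<bullet> b)\<^sup>2)))" for x
    by (subst L) (simp add: norm_power2_eq_sum_Basis exp_sum[symmetric] sum_subtractf)
  then show ?thesis
    using integral_lborel_prod[where 'a='a and f="\<lambda>b u. exp (L b * complex_of_real u - complex_of_real (u\<^sup>2))"]
    by (simp add: integrable_gaussian[simplified] integral_gaussian[simplified] prod.distrib exp_sum sum_divide_distrib)
qed

lemma sum_Basis_complex_vec:
  "(\<Sum>b\<in>Basis. F (b :: complex ^ 'n)) = (\<Sum>j\<in>UNIV. F (axis j 1) + F (axis j \<i>))"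
proof -
  have "(\<Sum>b\<in>Basis. F (b :: complex ^ 'n)) = (\<Sum>(j, u)\<in>UNIV \<times> Basis. F (axis j u))"
  proof (rule sum.reindex_cong)
    show "inj_on (\<lambda>(j, u). axis j u) (UNIV \<times> (Basis :: complex set))"
      by (auto simp: inj_on_def axis_eq_axis)
    show "(Basis :: (complex ^ 'n) set) = (\<lambda>(j, u). axis j u) ` (UNIV \<times> Basis)"
      by (auto simp: Basis_vec_def)
  qed auto
  also have "\<dots> = (\<Sum>j\<in>UNIV. \<Sum>u\<in>Basis. F (axis j u))" by (simp add: sum.cartesian_product)
  finally show ?thesis by (simp add: Basis_complex_def)
qed

section \<open>The Hermitian product and its Gaussian moments\<close>

lemma cnj_cinner: "cnj (cinner a b) = cinner b a"
  by (simp add: cinner_def mult.commute)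

lemma cinner_add_left: "cinner (a + b) c = cinner a c + cinner b c"
  by (simp add: cinner_def sum.distrib distrib_right)

lemma cinner_add_right: "cinner c (a + b) = cinner c a + cinner c b"
  by (simp add: cinner_def sum.distrib distrib_left)

lemma cinner_diff_left: "cinner (a - b) c = cinner a c - cinner b c"
  by (simp add: cinner_def sum_subtractf left_diff_distrib)

lemma cinner_diff_right: "cinner c (a - b) = cinner c a - cinner c b"
  by (simp add: cinner_def sum_subtractf right_diff_distrib)

lemma cinner_scale_left: "cinner (s *s a) c = s * cinner a c"
  by (simp add: cinner_def sum_distrib_left mult_ac)

lemma cinner_scale_right: "cinner c (s *s a) = cnj s * cinner c a"
  by (simp add: cinner_def sum_distrib_left mult_ac)

lemma cinner_scaleR_left: "cinner (r *\<^sub>R a) c = of_real r * cinner a c"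
  by (simp add: cinner_def sum_distrib_left mult_ac scaleR_conv_of_real[where 'a=complex])

lemma cinner_scaleR_right: "cinner c (r *\<^sub>R a) = of_real r * cinner c a"
  by (simp add: cinner_def sum_distrib_left mult_ac scaleR_conv_of_real[where 'a=complex])

lemma cinner_self: "cinner a a = complex_of_real ((norm a)\<^sup>2)"
  by (simp add: cinner_def norm_vec_def L2_set_def sum_nonneg complex_norm_square[symmetric])

lemma norm_cinner_le: "norm (cinner a b) \<le> norm a * norm b"
proof -
  have "norm (cinner a b) \<le> (\<Sum>j\<in>UNIV. norm (a $ j) * norm (b $ j))"
    unfolding cinner_def by (rule sum_norm_le) (simp add: norm_mult)
  also have "\<dots> \<le> norm a * norm b"
    using L2_set_mult_ineq[of "\<lambda>j. norm (a $ j)" "\<lambda>j. norm (b $ j)" UNIV] by (simp add: norm_vec_def)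
  finally show ?thesis .
qed

lemma continuous_on_cinner [continuous_intros]:
  "continuous_on S f \<Longrightarrow> continuous_on S g \<Longrightarrow> continuous_on S (\<lambda>x. cinner (f x) (g x))"
  unfolding cinner_def by (intro continuous_intros)

lemma borel_measurable_cinner [measurable]:
  "(\<lambda>x. cinner a x) \<in> borel_measurable borel" "(\<lambda>x. cinner x a) \<in> borel_measurable borel"
  by (intro borel_measurable_continuous_onI continuous_intros)+

lemma gaussian_moments_cinner:
  fixes a b :: "complex ^ 'n"
  shows "(\<integral>x. complex_of_real (exp (- (norm x)\<^sup>2)) * cinner a x ^ k * cinner x b ^ l \<partial>lborel)
    = (if k = l then of_real (pi ^ CARD('n)) * fact k * cinner a b ^ k else 0)"
proof -
  have "inverse (fact k) * inverse (fact l) *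
      (\<integral>x. complex_of_real (exp (- (norm x)\<^sup>2)) * cinner a x ^ k * cinner x b ^ l \<partial>lborel)
    = (if k = l then complex_of_real (pi ^ CARD('n)) * inverse (fact k) * cinner a b ^ k else 0)"
  proof (rule moments_from_generating_function[where c="\<lambda>k. inverse (fact k)"
        and d="\<lambda>k. complex_of_real (pi ^ CARD('n)) * inverse (fact k) * cinner a b ^ k"])
    have sums: "(\<lambda>k. norm (inverse (fact k) :: complex) * norm u ^ k) sums exp (norm u)" for u :: complex
      using exp_power_series[of "norm u"] by (simp add: norm_inverse)
    show "AE x in lborel. summable (\<lambda>k. norm (inverse (fact k) :: complex) * norm (cinner a x) ^ k)"
      "AE x in lborel. summable (\<lambda>k. norm (inverse (fact k) :: complex) * norm (cinner x b) ^ k)"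
      using sums by (auto simp: sums_iff)
    show "integrable lborel (\<lambda>x. norm (complex_of_real (exp (- (norm x)\<^sup>2))) *
        (\<Sum>k. norm (inverse (fact k) :: complex) * norm (cinner a x) ^ k) *
        (\<Sum>k. norm (inverse (fact k) :: complex) * norm (cinner x b) ^ k))"
      unfolding sums[THEN sums_unique, symmetric]
    proof (rule Bochner_Integration.integrable_bound[OF integrable_gaussian_sum_abs[of "norm a + norm b"]])
      have "norm (cinner a x) + norm (cinner x b) \<le> (norm a + norm b) * (\<Sum>b\<in>Basis. \<bar>x \<bullet> b\<bar>)" for x
      proof -
        have "norm (cinner a x) + norm (cinner x b) \<le> (norm a + norm b) * norm x"
          using norm_cinner_le[of a x] norm_cinner_le[of x b] by (simp add: algebra_simps)
        also have "\<dots> \<le> (norm a + norm b) * (\<Sum>b\<in>Basis. \<bar>x \<bullet> b\<bar>)"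
          by (intro mult_left_mono norm_le_l1) simp
        finally show ?thesis .
      qed
      then show "AE x in lborel. norm (norm (complex_of_real (exp (- (norm x)\<^sup>2))) * exp (norm (cinner a x)) * exp (norm (cinner x b)))
          \<le> norm (exp ((norm a + norm b) * (\<Sum>b\<in>Basis. \<bar>x \<bullet> b\<bar>) - (norm x)\<^sup>2))"
        by (auto simp: exp_add[symmetric] abs_mult)
    qed measurable
    fix s t :: complex
    let ?L = "\<lambda>x. s * cinner a x + t * cinner x b"
    have lin: "linear ?L"
      by (rule linearI) (simp_all add: cinner_add_left cinner_add_right cinner_scaleR_left cinner_scaleR_right
          scaleR_conv_of_real[where 'a=complex] algebra_simps)
    have axis: "cinner a (axis j u) = a $ j * cnj u" "cinner (axis j u) b = u * cnj (b $ j)" for j u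
      by (simp_all add: cinner_def axis_def if_distrib if_distribR cong: if_cong)
    \<comment> \<open>Coordinate j contributes (s a + t b')^2 - (s a - t b')^2 = 4 s t a b', with a
      = \<open>a $ j\<close> and b' = \<open>cnj (b $ j)\<close>: the direction \<i> flips the sign,
      so the pure squares cancel and only the product s * t survives.\<close>
    have sq: "(\<Sum>u\<in>Basis. (?L u)\<^sup>2) / 4 = s * t * cinner a b"
      unfolding sum_Basis_complex_vec axis
      by (simp add: cinner_def sum_distrib_left sum_divide_distrib power2_eq_square algebra_simps)
    have dim: "sqrt pi ^ DIM(complex ^ 'n) = pi ^ CARD('n)"
      by (simp add: power_mult power2_eq_square mult.commute[of _ 2])
    have "(\<integral>x. complex_of_real (exp (- (norm x)\<^sup>2)) * (\<Sum>k. inverse (fact k) * (s * cinner a x) ^ k) *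
         (\<Sum>k. inverse (fact k) * (t * cinner x b) ^ k) \<partial>lborel)
       = (\<integral>x. exp (?L x - complex_of_real ((norm x)\<^sup>2)) \<partial>lborel)"
      unfolding exp_suminf
      by (intro Bochner_Integration.integral_cong) (simp_all add: exp_add[symmetric] algebra_simps flip: exp_of_real)
    also have "\<dots> = complex_of_real (pi ^ CARD('n)) * exp (s * t * cinner a b)"
      unfolding integral_gaussian_linear[OF lin] sq dim ..
    finally show "(\<lambda>k. complex_of_real (pi ^ CARD('n)) * inverse (fact k) * cinner a b ^ k * (s * t) ^ k) sums
        (\<integral>x. complex_of_real (exp (- (norm x)\<^sup>2)) * (\<Sum>k. inverse (fact k) * (s * cinner a x) ^ k) *
         (\<Sum>k. inverse (fact k) * (t * cinner x b) ^ k) \<partial>lborel)"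
      using sums_mult[OF exp_power_series[of "s * t * cinner a b"], of "complex_of_real (pi ^ CARD('n))"]
      by (simp add: power_mult_distrib mult_ac)
  qed measurable
  then show ?thesis by (auto simp: field_simps split: if_splits)
qed

subsection \<open>Moments of the sphere\<close>

lemma lborel_integral_scaleR:
  fixes g :: "'a::euclidean_space \<Rightarrow> 'b::{banach, second_countable_topology}"
  assumes [measurable]: "g \<in> borel_measurable borel" and "c \<noteq> 0"
  shows "(\<integral>x. g x \<partial>lborel) = \<bar>c\<bar> ^ DIM('a) *\<^sub>R (\<integral>x. g (c *\<^sub>R x) \<partial>lborel)"
  by (subst lborel_affine[OF \<open>c \<noteq> 0\<close>, of 0]) (simp add: integral_density integral_distr)

text \<open>Layer cake: \<open>h\<close> is an integral of indicators of half lines, so the radial weight \<open>h (norm x)\<close>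
  is an integral of indicators of balls, on each of which homogeneity reduces \<open>G\<close> to the unit ball.\<close>

lemma integral_radial_mult_homogeneous:
  fixes G :: "'a::euclidean_space \<Rightarrow> complex" and h w :: "real \<Rightarrow> real"
  assumes [measurable]: "G \<in> borel_measurable borel" "w \<in> borel_measurable borel"
    and hom: "\<And>c x. 0 < c \<Longrightarrow> G (c *\<^sub>R x) = of_real (c ^ m) * G x"
    and bound: "\<And>x. norm x < 1 \<Longrightarrow> norm (G x) \<le> C"
    and h: "\<And>r. 0 \<le> r \<Longrightarrow> (\<integral>s. indicator {r<..} s * w s \<partial>lborel) = h r"
    and w: "integrable lborel (\<lambda>s. indicator {0<..} s * (s ^ (DIM('a) + m) * w s))"
  shows "(\<integral>x. of_real (h (norm x)) * G x \<partial>lborel)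
    = of_real (\<integral>s. indicator {0<..} s * (s ^ (DIM('a) + m) * w s) \<partial>lborel) * (\<integral>x. indicator (ball 0 1) x * G x \<partial>lborel)"
proof -
  define \<Phi> :: "real \<Rightarrow> 'a \<Rightarrow> complex" where
    "\<Phi> s x = of_real (indicator {norm x<..} s * w s) * G x" for s x
  define B where "B = (\<integral>x. indicator (ball 0 1) x * G x \<partial>lborel)"
  define B' where "B' = (\<integral>x. indicator (ball 0 1) x * norm (G x) \<partial>lborel)"
  have ind: "indicator {norm x<..} s = (if norm x < s then 1 else 0 :: real)" for x :: 'a and s
    by (auto simp: indicator_def)
  have [measurable]: "case_prod \<Phi> \<in> borel_measurable (lborel \<Otimes>\<^sub>M lborel)"
    unfolding \<Phi>_def ind by measurable
  have [measurable]: "\<Phi> s \<in> borel_measurable borel" for s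
    unfolding \<Phi>_def ind by measurable
  have intB: "integrable lborel (\<lambda>x. indicator (ball 0 1) x * G x)"
  proof (rule integrableI_bounded_set_indicator[where B=C, of "ball 0 1" lborel G, unfolded scaleR_conv_of_real, simplified of_real_indicator])
    show "emeasure lborel (ball 0 1 :: 'a set) < \<infinity>" by (rule emeasure_lborel_ball_finite)
  qed (use bound in auto)
  have scale: "indicator {norm (s *\<^sub>R x)<..} s = (indicator (ball 0 1) x :: real)" if "0 < s" for s and x :: 'a
    using that by (auto simp: indicator_def)
  have \<Phi>_scale: "\<Phi> s (s *\<^sub>R x) = of_real (w s * s ^ m) * (indicator (ball 0 1) x * G x)" if "0 < s" for s x
    unfolding \<Phi>_def scale[OF that] hom[OF that] by (simp add: indicator_def)
  have \<Phi>_neg: "\<Phi> s x = 0" if "\<not> 0 < s" for s x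
  proof -
    have "\<not> norm x < s" using that norm_ge_zero[of x] by linarith
    then show ?thesis by (simp add: \<Phi>_def)
  qed
  have inner: "(\<integral>x. \<Phi> s x \<partial>lborel) = of_real (indicator {0<..} s * (s ^ (DIM('a) + m) * w s)) * B" for s
  proof (cases "0 < s")
    case True
    have "(\<integral>x. \<Phi> s x \<partial>lborel) = \<bar>s\<bar> ^ DIM('a) *\<^sub>R (\<integral>x. \<Phi> s (s *\<^sub>R x) \<partial>lborel)"
      by (rule lborel_integral_scaleR) (use True in auto)
    also have "(\<integral>x. \<Phi> s (s *\<^sub>R x) \<partial>lborel) = of_real (w s * s ^ m) * B"
      unfolding \<Phi>_scale[OF True] B_def by (rule integral_mult_right_zero)
    finally show ?thesis using True
      by (simp add: scaleR_conv_of_real power_add mult_ac)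
  qed (simp add: \<Phi>_neg)
  have inner_norm: "(\<integral>x. norm (\<Phi> s x) \<partial>lborel) = norm (indicator {0<..} s * (s ^ (DIM('a) + m) * w s)) * B'" for s
  proof (cases "0 < s")
    case True
    have "(\<integral>x. norm (\<Phi> s x) \<partial>lborel) = \<bar>s\<bar> ^ DIM('a) *\<^sub>R (\<integral>x. norm (\<Phi> s (s *\<^sub>R x)) \<partial>lborel)"
      by (rule lborel_integral_scaleR) (use True in auto)
    also have "(\<lambda>x. norm (\<Phi> s (s *\<^sub>R x))) = (\<lambda>x. \<bar>w s * s ^ m\<bar> * (indicator (ball 0 1) x * norm (G x)))"
      using True by (auto simp: \<Phi>_scale norm_mult norm_power abs_mult fun_eq_iff split: split_indicator)
    also have "(\<integral>x. \<bar>w s * s ^ m\<bar> * (indicator (ball 0 1) x * norm (G x)) \<partial>lborel) = \<bar>w s * s ^ m\<bar> * B'"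
      unfolding B'_def by (rule integral_mult_right_zero)
    finally show ?thesis using True
      by (simp add: B'_def power_add mult_ac abs_mult)
  qed (simp add: \<Phi>_neg)
  have int_inner: "integrable lborel (\<Phi> s)" for s
  proof (cases "0 < s")
    case True
    have "integrable lborel (\<lambda>x. \<Phi> s (s *\<^sub>R x))"
      using intB by (simp add: \<Phi>_scale[OF True])
    then have "integrable (density (distr lborel borel (\<lambda>x. 0 + s *\<^sub>R x)) (\<lambda>_. ennreal (\<bar>s\<bar> ^ DIM('a)))) (\<Phi> s)"
      by (subst integrable_density) (use True in \<open>auto simp: integrable_distr_eq\<close>)
    then show ?thesis using lborel_affine[where 'a='a and c=s and t=0] True by simp
  next
    case False
    then have "\<Phi> s = (\<lambda>_. 0)" by (simp add: \<Phi>_neg fun_eq_iff)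
    then show ?thesis by simp
  qed
  have "integrable (lborel \<Otimes>\<^sub>M lborel) (case_prod \<Phi>)"
    by (rule lborel_pair.Fubini_integrable) (use w int_inner in \<open>auto simp: inner_norm\<close>)
  then have "(\<integral>x. (\<integral>s. \<Phi> s x \<partial>lborel) \<partial>lborel) = (\<integral>s. (\<integral>x. \<Phi> s x \<partial>lborel) \<partial>lborel)"
    by (rule lborel_pair.Fubini_integral)
  also have "\<dots> = of_real (\<integral>s. indicator {0<..} s * (s ^ (DIM('a) + m) * w s) \<partial>lborel) * B"
    unfolding inner by (simp only: integral_mult_left_zero integral_complex_of_real)
  also have "(\<lambda>x. \<integral>s. \<Phi> s x \<partial>lborel) = (\<lambda>x. of_real (h (norm x)) * G x)"
    unfolding \<Phi>_def by (simp only: integral_mult_left_zero integral_complex_of_real h[OF norm_ge_zero])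
  finally show ?thesis unfolding B_def .
qed

section \<open>Integration against the surface measure\<close>

lemma integral_sphere_measure:
  fixes F :: "complex ^ 'n \<Rightarrow> 'b::{banach, second_countable_topology}"
  assumes [measurable]: "F \<in> borel_measurable borel"
  shows "(\<integral>\<zeta>. F \<zeta> \<partial>sphere_measure) = real (2 * CARD('n)) *\<^sub>R (\<integral>x. indicator (ball 0 1) x *\<^sub>R F (sgn x) \<partial>lborel)"
proof -
  let ?M = "distr (restrict_space lborel (ball 0 1 - {0})) borel sgn :: (complex ^ 'n) measure"
  have sgn[measurable]: "sgn \<in> restrict_space lborel (ball 0 1 - {0 :: complex ^ 'n}) \<rightarrow>\<^sub>M borel"
    by (intro measurable_restrict_space1) simp
  have [measurable]: "(\<lambda>x. F (sgn x)) \<in> borel_measurable borel"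
    by (rule measurable_compose[OF borel_measurable_sgn assms])
  have [measurable]: "(\<lambda>x. indicator A x *\<^sub>R F (sgn x)) \<in> borel_measurable borel" if "A \<in> sets borel" for A
    using that by (intro borel_measurable_scaleR borel_measurable_indicator) auto
  have density: "sphere_measure = density ?M (\<lambda>_. ennreal (real (DIM(complex ^ 'n))))"
    unfolding sphere_measure_def
    by (rule measure_eqI) (auto simp: emeasure_density_const)
  have "(\<integral>\<zeta>. F \<zeta> \<partial>sphere_measure) = (\<integral>\<zeta>. real (DIM(complex ^ 'n)) *\<^sub>R F \<zeta> \<partial>?M)"
    unfolding density by (rule integral_density) auto
  also have "\<dots> = real (2 * CARD('n)) *\<^sub>R (\<integral>x. indicator (ball 0 1 - {0}) x *\<^sub>R F (sgn x) \<partial>lborel)"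
    by (simp add: integral_distr integral_restrict_space mult.commute)
  also have "(\<integral>x. indicator (ball 0 1 - {0}) x *\<^sub>R F (sgn x) \<partial>lborel) = (\<integral>x. indicator (ball 0 1) x *\<^sub>R F (sgn x) \<partial>lborel)"
    by (intro integral_cong_AE) (auto intro!: eventually_mono[OF AE_lborel_singleton[of 0]] split: split_indicator)
  finally show ?thesis .
qed

lemma AE_sphere_measure: "AE \<zeta> in sphere_measure. norm (\<zeta> :: complex ^ 'n) = 1"
proof (rule AE_I)
  let ?M = "restrict_space lborel (ball 0 1 - {0}) :: (complex ^ 'n) measure"
  have sgn[measurable]: "sgn \<in> ?M \<rightarrow>\<^sub>M borel"
    by (intro measurable_restrict_space1) simp
  have "sgn -` {\<zeta>. norm \<zeta> \<noteq> 1} \<inter> space ?M = {}"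
    by (auto simp: space_restrict_space norm_sgn)
  then show "emeasure sphere_measure {\<zeta> :: complex ^ 'n. norm \<zeta> \<noteq> 1} = 0"
    unfolding sphere_measure_def by (simp add: emeasure_distr)
qed (auto simp: sphere_measure_def space_scale_measure)

lemma sets_sphere_measure [measurable_cong, simp]: "sets sphere_measure = sets borel"
  by (simp add: sphere_measure_def)

lemma finite_measure_sphere_measure: "finite_measure (sphere_measure :: (complex ^ 'n) measure)"
proof
  have sgn[measurable]: "sgn \<in> restrict_space lborel (ball 0 1 - {0 :: complex ^ 'n}) \<rightarrow>\<^sub>M borel"
    by (intro measurable_restrict_space1) simp
  have "emeasure lborel (ball 0 1 - {0 :: complex ^ 'n}) \<le> emeasure lborel (ball 0 1 :: (complex ^ 'n) set)"
    by (intro emeasure_mono) auto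
  also have "\<dots> < \<infinity>" by (rule emeasure_lborel_ball_finite)
  finally have "emeasure lborel (ball 0 1 - {0 :: complex ^ 'n}) < \<infinity>" .
  then show "emeasure sphere_measure (space (sphere_measure :: (complex ^ 'n) measure)) \<noteq> \<infinity>"
    by (simp add: sphere_measure_def space_scale_measure emeasure_distr emeasure_restrict_space
        space_restrict_space ennreal_mult_eq_top_iff)
qed

section \<open>From Gaussian integrals to spherical integrals\<close>

definition half_gaussian_moment :: "nat \<Rightarrow> real" where
  "half_gaussian_moment j = (\<integral>s. indicator {0..} s * (exp (- s\<^sup>2) * s ^ j) \<partial>lborel)"

lemma
  shows integrable_half_gaussian_moment: "integrable lborel (\<lambda>s::real. indicator {0..} s * (exp (- s\<^sup>2) * s ^ j))"
    and half_gaussian_moment_odd: "half_gaussian_moment (2 * k + 1) = fact k / 2"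
    and half_gaussian_moment_pos: "0 < half_gaussian_moment j"
proof -
  note even = gaussian_moment_even_pos[unfolded has_bochner_integral_iff real_scaleR_def]
  note odd = gaussian_moment_odd_pos[unfolded has_bochner_integral_iff real_scaleR_def]
  show "half_gaussian_moment (2 * k + 1) = fact k / 2"
    using odd[of k] by (simp add: half_gaussian_moment_def)
  have "integrable lborel (\<lambda>s::real. indicator {0..} s * (exp (- s\<^sup>2) * s ^ j)) \<and> 0 < half_gaussian_moment j"
  proof (cases "even j")
    case True
    then obtain i where "j = 2 * i" by (rule evenE)
    then show ?thesis using even[of i] by (simp add: half_gaussian_moment_def)
  next
    case False
    then obtain i where "j = 2 * i + 1" by (rule oddE)
    then have eq: "half_gaussian_moment j = fact i / 2" using odd[of i] by (simp add: half_gaussian_moment_def)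
    have "0 < half_gaussian_moment j" unfolding eq by simp
    then show ?thesis using odd[of i] \<open>j = 2 * i + 1\<close> by simp
  qed
  then show "integrable lborel (\<lambda>s::real. indicator {0..} s * (exp (- s\<^sup>2) * s ^ j))" "0 < half_gaussian_moment j"
    by auto
qed

text \<open>Layer-cake density of the Gaussian profile: the integrand is the derivative of
  -exp(-s^2).\<close>

lemma integral_half_line_gaussian:
  fixes r :: real
  assumes "0 \<le> r"
  shows "(\<integral>s. indicator {r<..} s * (2 * s * exp (- s\<^sup>2)) \<partial>lborel) = exp (- r\<^sup>2)"
proof -
  have "(\<integral>\<^sup>+s. ennreal (2 * s * exp (- s\<^sup>2)) * indicator {r..} s \<partial>lborel) = ennreal (0 - (- exp (- r\<^sup>2)))"
  proof (rule nn_integral_FTC_atLeast)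
    show "DERIV (\<lambda>s. - exp (- s\<^sup>2)) x :> 2 * x * exp (- x\<^sup>2)" for x :: real
      by (auto intro!: derivative_eq_intros)
    show "((\<lambda>s. - exp (- s\<^sup>2)) \<longlongrightarrow> 0) (at_top :: real filter)"
      by real_asymp
  qed (use assms in auto)
  also have "(\<integral>\<^sup>+s. ennreal (2 * s * exp (- s\<^sup>2)) * indicator {r..} s \<partial>lborel)
      = (\<integral>\<^sup>+s. ennreal (indicator {r<..} s * (2 * s * exp (- s\<^sup>2))) \<partial>lborel)"
    by (intro nn_integral_cong_AE eventually_mono[OF AE_lborel_singleton[of r]]) (auto split: split_indicator)
  finally show ?thesis
    by (intro integral_eq_nn_integral[THEN trans]) (use assms in \<open>auto intro!: AE_I2 split: split_indicator\<close>)
qed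

text \<open>The density m s^(m-1) on s \<le> 1 is the layer-cake density of the profile 1 - r^m. The
  case N = 0 recovers this profile; r = 0 with N the real dimension gives the constant by which the
  ball integral is multiplied.\<close>

lemma integral_FTC_interval_power:
  fixes r :: real
  assumes "0 \<le> r" "r \<le> 1"
  shows "integrable lborel (\<lambda>s. indicator {r<..} s * (s ^ N * (real m * s ^ (m - 1) * indicator {..1} s)))"
    and "(\<integral>s. indicator {r<..} s * (s ^ N * (real m * s ^ (m - 1) * indicator {..1} s)) \<partial>lborel)
      = real m / real (N + m) * (1 - r ^ (N + m))"
proof -
  have "has_bochner_integral lborel (\<lambda>s. (s ^ N * (real m * s ^ (m - 1))) * indicator {r..1} s)
     (real m / real (N + m) * 1 ^ (N + m) - real m / real (N + m) * r ^ (N + m))"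
  proof (rule has_bochner_integral_FTC_Icc_real)
    fix x :: real
    show "DERIV (\<lambda>s. real m / real (N + m) * s ^ (N + m)) x :> x ^ N * (real m * x ^ (m - 1))"
    proof (cases "m = 0")
      case False
      then have "real m / real (N + m) * (real (N + m) * x ^ (N + m - Suc 0)) = x ^ N * (real m * x ^ (m - 1))"
        by (simp add: power_add[symmetric])
      then show ?thesis by (metis DERIV_cmult DERIV_pow)
    qed simp
  qed (use assms in auto)
  moreover have "AE s in lborel. (s ^ N * (real m * s ^ (m - 1))) * indicator {r..1} s
      = indicator {r<..} s * (s ^ N * (real m * s ^ (m - 1) * indicator {..1} s))"
    using AE_lborel_singleton[of r] by eventually_elim (auto split: split_indicator)
  ultimately have "has_bochner_integral lborel (\<lambda>s. indicator {r<..} s * (s ^ N * (real m * s ^ (m - 1) * indicator {..1} s)))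
     (real m / real (N + m) * (1 - r ^ (N + m)))"
    by (subst (asm) has_bochner_integral_cong_AE) (auto simp: right_diff_distrib)
  then show "integrable lborel (\<lambda>s. indicator {r<..} s * (s ^ N * (real m * s ^ (m - 1) * indicator {..1} s)))"
    "(\<integral>s. indicator {r<..} s * (s ^ N * (real m * s ^ (m - 1) * indicator {..1} s)) \<partial>lborel)
      = real m / real (N + m) * (1 - r ^ (N + m))"
    by (auto simp: has_bochner_integral_iff)
qed

text \<open>Two layer-cake computations replace polar coordinates. The Gaussian profile applied to G
  gives a multiple of the ball integral \<open>B\<close> of G. The profile 1 - r^m applied to the
  degree-zero function \<open>G (sgn x)\<close>, whose ball integral is \<open>S\<close>, gives S -
  B = m / (N + m) * S, because G x equals norm x ^ m times G (sgn x). Hence B = N / (N + m) * S, and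
  N * S is the integral over the sphere.\<close>

lemma integral_gaussian_homogeneous:
  fixes G :: "complex ^ 'n \<Rightarrow> complex"
  assumes [measurable]: "G \<in> borel_measurable borel"
    and hom: "\<And>c x. 0 < c \<Longrightarrow> G (c *\<^sub>R x) = of_real (c ^ m) * G x"
    and bound: "\<And>x. norm x \<le> 1 \<Longrightarrow> norm (G x) \<le> C"
  shows "(\<integral>x. of_real (exp (- (norm x)\<^sup>2)) * G x \<partial>lborel)
    = of_real (2 * half_gaussian_moment (2 * CARD('n) + m + 1) / real (2 * CARD('n) + m)) * (\<integral>\<zeta>. G \<zeta> \<partial>sphere_measure)"
proof -
  define N where "N = 2 * CARD('n)"
  have N: "DIM(complex ^ 'n) = N" by (simp add: N_def mult.commute)
  have "0 < N" by (simp add: N_def)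
  define B where "B = (\<integral>x. indicator (ball 0 1) x * G x \<partial>lborel)"
  define S where "S = (\<integral>x. indicator (ball 0 1) x * G (sgn x) \<partial>lborel)"
  have radial: "G x = of_real (norm x ^ m) * G (sgn x)" for x
  proof (cases "x = 0")
    case True
    \<comment> \<open>At the origin \<open>sgn\<close> returns 0, and homogeneity under doubling
      forces G 0 = 0 when m is positive.\<close>
    have "of_real (2 ^ m) \<noteq> (1::complex)" if "m \<noteq> 0"
      using that one_less_power[of "2::real" m] unfolding of_real_eq_1_iff by linarith
    then show ?thesis using hom[of 2 x] True by (cases "m = 0") auto
  next
    case False
    then show ?thesis using hom[of "norm x" "sgn x"] by (simp add: sgn_div_norm)
  qed
  have int1: "indicator {0<..} s * (s ^ (N + m) * (2 * s * exp (- s\<^sup>2))) = 2 * (indicator {0..} s * (exp (- s\<^sup>2) * s ^ (N + m + 1)))" for s :: real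
    by (auto split: split_indicator)
  have gauss: "(\<integral>x. of_real (exp (- (norm x)\<^sup>2)) * G x \<partial>lborel) = of_real (2 * half_gaussian_moment (N + m + 1)) * B"
    unfolding B_def
  proof (subst integral_radial_mult_homogeneous[where w="\<lambda>s. 2 * s * exp (- s\<^sup>2)" and C=C and m=m])
    show "integrable lborel (\<lambda>s::real. indicator {0<..} s * (s ^ (DIM(complex ^ 'n) + m) * (2 * s * exp (- s\<^sup>2))))"
      unfolding N int1 by (intro integrable_mult_right integrable_half_gaussian_moment)
  next
    show "of_real (\<integral>s. indicator {0<..} s * (s ^ (DIM(complex ^ 'n) + m) * (2 * s * exp (- s\<^sup>2))) \<partial>lborel) *
        (\<integral>x. indicator (ball 0 1) x * G x \<partial>lborel)
      = of_real (2 * half_gaussian_moment (N + m + 1)) * (\<integral>x. indicator (ball 0 1) x * G x \<partial>lborel)"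
      unfolding N int1 half_gaussian_moment_def by (simp only: integral_mult_right_zero)
  qed (use hom bound in \<open>auto simp: integral_half_line_gaussian\<close>)
  have "(\<integral>x. of_real (if norm x \<le> 1 then 1 - norm x ^ m else 0) * G (sgn x) \<partial>lborel)
      = of_real (real m / real (N + m)) * S"
    unfolding S_def
  proof (subst integral_radial_mult_homogeneous[where w="\<lambda>s. real m * s ^ (m - 1) * indicator {..1} s"
        and C=C and m=0 and h="\<lambda>r. if r \<le> 1 then 1 - r ^ m else 0"])
    fix r :: real assume r: "0 \<le> r"
    show "(\<integral>s. indicator {r<..} s * (real m * s ^ (m - 1) * indicator {..1} s) \<partial>lborel) = (if r \<le> 1 then 1 - r ^ m else 0)"
    proof (cases "r \<le> 1")
      case True
      then show ?thesis using integral_FTC_interval_power(2)[OF r True, of 0 m] by (cases "m = 0") auto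
    next
      case False
      then have zero: "(\<lambda>s. indicator {r<..} s * (real m * s ^ (m - 1) * indicator {..1} s)) = (\<lambda>_. 0)"
        by (auto split: split_indicator)
      show ?thesis unfolding zero using False by simp
    qed
  next
    show "integrable lborel (\<lambda>s. indicator {0<..} s * (s ^ (DIM(complex ^ 'n) + 0) * (real m * s ^ (m - 1) * indicator {..1} s)))"
      using integral_FTC_interval_power(1)[of 0 N m] unfolding N by simp
  next
    show "of_real (\<integral>s. indicator {0<..} s * (s ^ (DIM(complex ^ 'n) + 0) * (real m * s ^ (m - 1) * indicator {..1} s)) \<partial>lborel) *
        (\<integral>x. indicator (ball 0 1) x * G (sgn x) \<partial>lborel)
      = of_real (real m / real (N + m)) * (\<integral>x. indicator (ball 0 1) x * G (sgn x) \<partial>lborel)"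
      using integral_FTC_interval_power(2)[of 0 N m] \<open>0 < N\<close> unfolding N by simp
  qed (use bound in \<open>auto simp: sgn_scaleR norm_sgn\<close>)
  also have "(\<integral>x. of_real (if norm x \<le> 1 then 1 - norm x ^ m else 0) * G (sgn x) \<partial>lborel)
      = (\<integral>x. indicator (ball 0 1) x * G (sgn x) - indicator (ball 0 1) x * G x \<partial>lborel)"
  proof (rule Bochner_Integration.integral_cong[OF refl])
    fix x :: "complex ^ 'n"
    have "of_real (1 - norm x ^ m) * G (sgn x) = G (sgn x) - G x"
      using radial[of x] by (simp add: algebra_simps)
    \<comment> \<open>The closed condition and the open ball differ only where norm x = 1, and there
      the profile 1 - norm x ^ m vanishes.\<close>
    then show "of_real (if norm x \<le> 1 then 1 - norm x ^ m else 0) * G (sgn x)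
        = indicator (ball 0 1) x * G (sgn x) - indicator (ball 0 1) x * G x"
      by (cases "norm x = 1") (auto split: split_indicator)
  qed
  also have "\<dots> = S - B"
  proof -
    have int: "integrable lborel (\<lambda>x. indicator (ball 0 1) x * H x)"
      if [measurable]: "H \<in> borel_measurable borel" and H: "\<And>x. norm x \<le> 1 \<Longrightarrow> norm (H x) \<le> C" for H :: "complex ^ 'n \<Rightarrow> complex"
    proof (rule integrableI_bounded_set_indicator[where B=C, of "ball 0 1" lborel H, unfolded scaleR_conv_of_real, simplified of_real_indicator])
      show "emeasure lborel (ball 0 1 :: (complex ^ 'n) set) < \<infinity>" by (rule emeasure_lborel_ball_finite)
    qed (use H in auto)
    show ?thesis unfolding S_def B_def
      by (intro Bochner_Integration.integral_diff int) (use bound in \<open>auto simp: norm_sgn\<close>)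
  qed
  finally have "B = of_real (real N / real (N + m)) * S"
    using \<open>0 < N\<close> by (simp add: field_simps of_nat_add[symmetric] del: of_nat_add) (simp add: algebra_simps)
  moreover have "(\<integral>\<zeta>. G \<zeta> \<partial>sphere_measure) = of_real (real N) * S"
    by (simp add: integral_sphere_measure S_def N_def scaleR_conv_of_real of_real_indicator)
  ultimately show ?thesis
    unfolding gauss N_def[symmetric] by simp
qed

text \<open>Quotient of a Gaussian moment by the radial factor. For k = l the radial factor is (n +
  k - 1)! / 2 = Gamma(n) (n)_k / 2; for k \<noteq> l it only has to be nonzero, as the Gaussian
  moment is zero.\<close>

lemma sphere_moments:
  fixes a b :: "complex ^ 'n"
  shows "(\<integral>\<zeta>. cinner a \<zeta> ^ k * cinner \<zeta> b ^ l \<partial>sphere_measure)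
    = (if k = l then of_real (2 * pi ^ CARD('n) / Gamma (real CARD('n))) * fact k / pochhammer (of_nat CARD('n)) k * cinner a b ^ k else 0)"
proof -
  define n where "n = CARD('n)"
  have "0 < n" by (simp add: n_def)
  define I where "I = (\<integral>\<zeta>. cinner a \<zeta> ^ k * cinner \<zeta> b ^ l \<partial>sphere_measure)"
  have "(\<integral>x. of_real (exp (- (norm x)\<^sup>2)) * (cinner a x ^ k * cinner x b ^ l) \<partial>lborel)
      = of_real (2 * half_gaussian_moment (2 * CARD('n) + (k + l) + 1) / real (2 * CARD('n) + (k + l))) * I"
    unfolding I_def
  proof (rule integral_gaussian_homogeneous)
    fix x :: "complex ^ 'n" assume x: "norm x \<le> 1"
    have "norm (cinner a x) \<le> norm a" "norm (cinner x b) \<le> norm b"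
      using norm_cinner_le[of a x] norm_cinner_le[of x b] x
      by (meson mult_left_le mult_left_le_one_le norm_ge_zero order_trans)+
    then show "norm (cinner a x ^ k * cinner x b ^ l) \<le> norm a ^ k * norm b ^ l"
      by (auto simp: norm_mult norm_power intro!: mult_mono power_mono)
  qed (auto simp: cinner_scaleR_left cinner_scaleR_right power_mult_distrib power_add)
  then have eq: "of_real (2 * half_gaussian_moment (2 * n + (k + l) + 1) / real (2 * n + (k + l))) * I
      = (if k = l then of_real (pi ^ n) * fact k * cinner a b ^ k else 0)"
    using gaussian_moments_cinner[of a k b l] by (simp add: n_def mult.assoc)
  show ?thesis
  proof (cases "k = l")
    case False
    have "2 * half_gaussian_moment (2 * n + (k + l) + 1) / real (2 * n + (k + l)) \<noteq> 0"
      using half_gaussian_moment_pos[of "2 * n + (k + l) + 1"] \<open>0 < n\<close> by simp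
    then have "I = 0" using eq False by (simp only: mult_eq_0_iff of_real_eq_0_iff if_False simp_thms)
    with False show ?thesis by (simp add: I_def)
  next
    case True
    have "half_gaussian_moment (2 * n + (k + l) + 1) = fact (n + k) / 2"
      using half_gaussian_moment_odd[of "n + k"] True by (simp add: algebra_simps)
    moreover have "fact (n + k) = real (n + k) * fact (n + k - 1)"
      using \<open>0 < n\<close> by (intro fact_reduce) simp
    moreover have nonpos: "real n \<notin> \<int>\<^sub>\<le>\<^sub>0"
      using \<open>0 < n\<close> nonpos_Ints_nonpos[of "real n"] by auto
    ultimately have "2 * half_gaussian_moment (2 * n + (k + l) + 1) / real (2 * n + (k + l)) = fact (n + k - 1) / 2"
      using True \<open>0 < n\<close> by (simp add: field_simps)
    also have "fact (n + k - 1) = Gamma (real n) * pochhammer (real n) k"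
      using pochhammer_Gamma[OF nonpos, of k] Gamma_fact[of "n + k - 1", where 'a=real] \<open>0 < n\<close>
      by (auto simp: field_simps of_nat_diff Gamma_eq_zero_iff)
    finally have coef: "2 * half_gaussian_moment (2 * n + (k + l) + 1) / real (2 * n + (k + l))
        = Gamma (real n) * pochhammer (real n) k / 2" .
    have "of_real (Gamma (real n) * pochhammer (real n) k / 2) * I = of_real (pi ^ n) * fact k * cinner a b ^ k"
      using eq True unfolding coef by simp
    moreover have "Gamma (real n) \<noteq> 0" "pochhammer (real n) k \<noteq> 0"
      using \<open>0 < n\<close> nonpos pochhammer_pos[of "real n" k] by (auto simp: Gamma_eq_zero_iff)
    moreover have "pochhammer (of_nat n) k = complex_of_real (pochhammer (real n) k)"
      by (simp add: pochhammer_of_real[symmetric])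
    ultimately show ?thesis using True
      unfolding I_def[symmetric] n_def[symmetric] by (simp add: field_simps)
  qed
qed

subsection \<open>The Szego kernel formula on the sphere\<close>

text \<open>The coefficient of x^k in (1 - x)^(-n). It is polymorphic so that the real coefficients
  can serve as the norms of the complex ones.\<close>

definition neg_binomial_coeff :: "nat \<Rightarrow> nat \<Rightarrow> 'a :: field_char_0" where
  "neg_binomial_coeff n k = pochhammer (of_nat n) k / fact k"

lemma pochhammer_of_nat_neq_0: "0 < n \<Longrightarrow> pochhammer (of_nat n :: 'a :: field_char_0) k \<noteq> 0"
  by (auto simp: pochhammer_eq_0_iff eq_neg_iff_add_eq_0 simp flip: of_nat_add)

lemma norm_neg_binomial_coeff: "norm (neg_binomial_coeff n k :: complex) = neg_binomial_coeff n k"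
proof -
  have "(neg_binomial_coeff n k :: complex) = of_real (neg_binomial_coeff n k)"
    by (simp add: neg_binomial_coeff_def pochhammer_of_real[symmetric])
  moreover have "0 \<le> (neg_binomial_coeff n k :: real)"
    by (simp add: neg_binomial_coeff_def pochhammer_prod prod_nonneg)
  ultimately show ?thesis by (simp only: norm_of_real abs_of_nonneg)
qed

lemma neg_binomial_sums:
  fixes x :: complex
  assumes "norm x < 1"
  shows "(\<lambda>k. neg_binomial_coeff n k * x ^ k) sums inverse (1 - x) ^ n"
proof -
  have "(-1) ^ k * ((of_nat n + of_nat k - 1) gchoose k) * (- x) ^ k = neg_binomial_coeff n k * x ^ k" for k
  proof -
    have "((of_nat n + of_nat k - 1 :: complex) gchoose k) = neg_binomial_coeff n k"
      unfolding gbinomial_pochhammer' neg_binomial_coeff_def by (simp add: algebra_simps)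
    moreover have "(-1) ^ k * (- x) ^ k = x ^ k" by (simp flip: power_mult_distrib)
    ultimately show ?thesis by (metis mult.assoc mult.commute)
  qed
  moreover have "(1 + - x) powr (- of_nat n) = inverse (1 - x) ^ n"
  proof -
    have "1 - x \<noteq> 0" using assms by auto
    then show ?thesis by (simp add: powr_minus powr_nat' power_inverse)
  qed
  ultimately show ?thesis
    using one_plus_neg_powr_powser[of "- x" "of_nat n"] assms by simp
qed

lemma summable_neg_binomial:
  fixes r :: real
  assumes "0 \<le> r" "r < 1"
  shows "summable (\<lambda>k. neg_binomial_coeff n k * r ^ k)"
proof -
  \<comment> \<open>Convergence at a radius strictly larger than r yields absolute convergence at
    r.\<close>
  obtain u where u: "r < u" "u < 1" using assms dense by blast
  have "summable (\<lambda>k. norm (neg_binomial_coeff n k * (of_real r :: complex) ^ k))"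
  proof (rule powser_insidea)
    show "summable (\<lambda>k. neg_binomial_coeff n k * (of_real u :: complex) ^ k)"
      using neg_binomial_sums[of "of_real u" n] u assms by (auto simp: sums_iff)
  qed (use u assms in auto)
  then show ?thesis using assms by (simp add: norm_mult norm_power norm_neg_binomial_coeff)
qed

lemma neg_binomial_suminf_le:
  fixes x :: complex
  assumes "norm x \<le> r" "r < 1"
  shows "summable (\<lambda>k. norm (neg_binomial_coeff n k :: complex) * norm x ^ k)"
    and "(\<Sum>k. norm (neg_binomial_coeff n k :: complex) * norm x ^ k) \<le> (\<Sum>k. neg_binomial_coeff n k * r ^ k)"
proof -
  show s: "summable (\<lambda>k. norm (neg_binomial_coeff n k :: complex) * norm x ^ k)"
    using summable_neg_binomial[of "norm x" n] assms by (simp add: norm_neg_binomial_coeff)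
  show "(\<Sum>k. norm (neg_binomial_coeff n k :: complex) * norm x ^ k) \<le> (\<Sum>k. neg_binomial_coeff n k * r ^ k)"
  proof (rule suminf_le[OF _ s])
    show "summable (\<lambda>k. neg_binomial_coeff n k * r ^ k)"
      using assms norm_ge_zero[of x] by (intro summable_neg_binomial) linarith+
    show "norm (neg_binomial_coeff n k :: complex) * norm x ^ k \<le> neg_binomial_coeff n k * r ^ k" for k
      using assms by (metis mult_left_mono norm_ge_zero norm_neg_binomial_coeff power_mono)
  qed
qed

text \<open>On the sphere f stays in a disc of radius r < 1, so a constant is a majorant, integrable
  because the surface measure is finite.\<close>

lemma sphere_integral_neg_binomial:
  fixes F f :: "complex ^ 'n \<Rightarrow> complex"
  assumes [measurable]: "F \<in> borel_measurable borel" "f \<in> borel_measurable borel"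
    and F: "\<And>\<zeta>. norm \<zeta> = 1 \<Longrightarrow> norm (F \<zeta>) \<le> C"
    and f: "\<And>\<zeta>. norm \<zeta> = 1 \<Longrightarrow> norm (f \<zeta>) \<le> r" and "r < 1"
  shows "(\<lambda>k. neg_binomial_coeff n k * (\<integral>\<zeta>. F \<zeta> * f \<zeta> ^ k \<partial>sphere_measure))
    sums (\<integral>\<zeta>. F \<zeta> * inverse (1 - f \<zeta>) ^ n \<partial>sphere_measure)"
proof -
  interpret finite_measure "sphere_measure :: (complex ^ 'n) measure"
    by (rule finite_measure_sphere_measure)
  have "(\<lambda>k. neg_binomial_coeff n k * (\<integral>\<zeta>. F \<zeta> * f \<zeta> ^ k \<partial>sphere_measure))
    sums (\<integral>\<zeta>. F \<zeta> * (\<Sum>k. neg_binomial_coeff n k * f \<zeta> ^ k) \<partial>sphere_measure)"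
  proof (rule integral_power_series)
    show "integrable sphere_measure (\<lambda>_ :: complex ^ 'n. C * (\<Sum>k. neg_binomial_coeff n k * r ^ k))" by simp
    show "AE \<zeta> in sphere_measure. summable (\<lambda>k. norm (neg_binomial_coeff n k :: complex) * norm (f \<zeta>) ^ k)"
      using AE_sphere_measure by eventually_elim (rule neg_binomial_suminf_le(1)[OF f \<open>r < 1\<close>])
    show "AE \<zeta> in sphere_measure. norm (F \<zeta>) * (\<Sum>k. norm (neg_binomial_coeff n k :: complex) * norm (f \<zeta>) ^ k)
        \<le> C * (\<Sum>k. neg_binomial_coeff n k * r ^ k)"
      using AE_sphere_measure
    proof eventually_elim
      case (elim \<zeta>)
      have "0 \<le> (\<Sum>k. norm (neg_binomial_coeff n k :: complex) * norm (f \<zeta>) ^ k)"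
        by (rule suminf_nonneg[OF neg_binomial_suminf_le(1)[OF f[OF elim] \<open>r < 1\<close>]]) simp
      then show ?case
        using F[OF elim] order_trans[OF norm_ge_zero F[OF elim]]
        by (intro mult_mono neg_binomial_suminf_le(2)[OF f[OF elim] \<open>r < 1\<close>]) auto
    qed
  qed measurable
  also have "(\<integral>\<zeta>. F \<zeta> * (\<Sum>k. neg_binomial_coeff n k * f \<zeta> ^ k) \<partial>sphere_measure)
      = (\<integral>\<zeta>. F \<zeta> * inverse (1 - f \<zeta>) ^ n \<partial>sphere_measure)"
  proof (rule integral_cong_AE)
    show "AE \<zeta> in sphere_measure. F \<zeta> * (\<Sum>k. neg_binomial_coeff n k * f \<zeta> ^ k) = F \<zeta> * inverse (1 - f \<zeta>) ^ n"
      using AE_sphere_measure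
    proof eventually_elim
      case (elim \<zeta>)
      then have "norm (f \<zeta>) < 1" using f \<open>r < 1\<close> by fastforce
      then show ?case using neg_binomial_sums[of "f \<zeta>" n] by (simp add: sums_iff)
    qed
  qed measurable
  finally show ?thesis .
qed

lemma norm_inverse_one_minus_le:
  fixes x :: complex
  assumes "norm x \<le> r" "r < 1"
  shows "norm (inverse (1 - x) ^ n) \<le> inverse (1 - r) ^ n"
proof -
  have "1 - r \<le> norm (1 - x)" using norm_triangle_ineq2[of 1 x] assms by simp
  then show ?thesis using assms by (auto simp: norm_power norm_inverse intro!: power_mono le_imp_inverse_le)
qed

section \<open>The Szego integral\<close>

definition sphere_area :: "nat \<Rightarrow> real" where
  "sphere_area n = 2 * pi ^ n / Gamma (real n)"

text \<open>Both factors are expanded. Orthogonality keeps the diagonal terms, and each moment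
  cancels one of its two equal coefficients; the series that remains is that of (1 - <u,v>)^(-n).
  The cancellation relies on the exponent being the complex dimension.\<close>

lemma sphere_integral_kernel_unit:
  fixes u v :: "complex ^ 'n"
  assumes u: "norm u < 1" and v: "norm v < 1"
  shows "(\<integral>\<zeta>. inverse (1 - cinner u \<zeta>) ^ CARD('n) * inverse (1 - cinner \<zeta> v) ^ CARD('n) \<partial>sphere_measure)
    = of_real (sphere_area CARD('n)) * inverse (1 - cinner u v) ^ CARD('n)"
proof -
  define n where "n = CARD('n)"
  have bu: "norm (cinner u \<zeta>) \<le> norm u" and bv: "norm (cinner \<zeta> v) \<le> norm v" if "norm \<zeta> = 1" for \<zeta> :: "complex ^ 'n"
    using norm_cinner_le[of u \<zeta>] norm_cinner_le[of \<zeta> v] that by auto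
  have "(\<lambda>k. neg_binomial_coeff n k * (\<integral>\<zeta>. inverse (1 - cinner \<zeta> v) ^ n * cinner u \<zeta> ^ k \<partial>sphere_measure))
      sums (\<integral>\<zeta>. inverse (1 - cinner \<zeta> v) ^ n * inverse (1 - cinner u \<zeta>) ^ n \<partial>sphere_measure)"
    by (rule sphere_integral_neg_binomial[where r="norm u" and C="inverse (1 - norm v) ^ n"])
      (use bu bv u v in \<open>auto intro!: norm_inverse_one_minus_le\<close>)
  moreover have "(\<integral>\<zeta>. inverse (1 - cinner \<zeta> v) ^ n * cinner u \<zeta> ^ k \<partial>sphere_measure)
      = of_real (sphere_area n) * cinner u v ^ k" for k
  proof -
    have "(\<lambda>l. neg_binomial_coeff n l * (\<integral>\<zeta>. cinner u \<zeta> ^ k * cinner \<zeta> v ^ l \<partial>sphere_measure))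
      sums (\<integral>\<zeta>. cinner u \<zeta> ^ k * inverse (1 - cinner \<zeta> v) ^ n \<partial>sphere_measure)"
      by (rule sphere_integral_neg_binomial[where r="norm v" and C="norm u ^ k"])
        (use bu bv u v in \<open>auto simp: norm_power intro!: power_mono\<close>)
    moreover have "neg_binomial_coeff n l * (\<integral>\<zeta>. cinner u \<zeta> ^ k * cinner \<zeta> v ^ l \<partial>sphere_measure)
        = (if l = k then of_real (sphere_area n) * cinner u v ^ k else 0)" for l
    proof -
      have "pochhammer (of_nat n :: complex) k \<noteq> 0"
        by (rule pochhammer_of_nat_neq_0) (simp add: n_def)
      then show ?thesis
        by (auto simp: sphere_moments sphere_area_def neg_binomial_coeff_def n_def)
    qed
    ultimately have "(\<lambda>l. if l = k then of_real (sphere_area n) * cinner u v ^ k else 0)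
        sums (\<integral>\<zeta>. cinner u \<zeta> ^ k * inverse (1 - cinner \<zeta> v) ^ n \<partial>sphere_measure)" by simp
    then show ?thesis
      using sums_unique2[OF _ sums_single[of k "\<lambda>_. of_real (sphere_area n) * cinner u v ^ k"]] by (simp add: mult.commute)
  qed
  ultimately have "(\<lambda>k. of_real (sphere_area n) * (neg_binomial_coeff n k * cinner u v ^ k))
      sums (\<integral>\<zeta>. inverse (1 - cinner u \<zeta>) ^ n * inverse (1 - cinner \<zeta> v) ^ n \<partial>sphere_measure)"
    by (simp add: mult_ac)
  moreover have "norm (cinner u v) < 1"
    using norm_cinner_le[of u v] u mult_left_mono[of "norm v" 1 "norm u"] v by simp
  then have "(\<lambda>k. of_real (sphere_area n) * (neg_binomial_coeff n k * cinner u v ^ k))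
      sums (of_real (sphere_area n) * inverse (1 - cinner u v) ^ n)"
    by (intro sums_mult neg_binomial_sums)
  ultimately show ?thesis unfolding n_def by (rule sums_unique2)
qed

lemma norm_scale_vec: "norm (c *s u) = norm c * norm (u :: complex ^ 'n)"
  by (simp add: norm_vec_def L2_set_def norm_mult power_mult_distrib sum_distrib_left[symmetric] real_sqrt_mult)

text \<open>Homogeneous form of the unit case, obtained by dividing u by a and v by b. It is
  required because the affine numerators of the Moebius pencils have arbitrary constant
  terms.\<close>

lemma sphere_integral_kernel:
  fixes u v :: "complex ^ 'n" and a b :: complex
  assumes u: "norm u < norm a" and v: "norm v < norm b"
  shows "(\<integral>\<zeta>. inverse (a - cinner u \<zeta>) ^ CARD('n) * inverse (cnj b - cinner \<zeta> v) ^ CARD('n) \<partial>sphere_measure)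
    = of_real (sphere_area CARD('n)) * inverse (a * cnj b - cinner u v) ^ CARD('n)"
proof -
  have a: "a \<noteq> 0" and b: "b \<noteq> 0" using u v norm_ge_zero[of u] norm_ge_zero[of v] by (auto simp del: norm_ge_zero)
  define u' v' where "u' = inverse a *s u" and "v' = inverse b *s v"
  have "norm u' < 1" "norm v' < 1"
    using u v a b by (simp_all add: u'_def v'_def norm_scale_vec norm_inverse inverse_eq_divide[of "norm _"])
  have "a - cinner u \<zeta> = a * (1 - cinner u' \<zeta>)" "cnj b - cinner \<zeta> v = cnj b * (1 - cinner \<zeta> v')" for \<zeta>
    using a b by (simp_all add: u'_def v'_def cinner_scale_left cinner_scale_right field_simps)
  then have "(\<integral>\<zeta>. inverse (a - cinner u \<zeta>) ^ CARD('n) * inverse (cnj b - cinner \<zeta> v) ^ CARD('n) \<partial>sphere_measure)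
      = (\<integral>\<zeta>. inverse (a * cnj b) ^ CARD('n) * (inverse (1 - cinner u' \<zeta>) ^ CARD('n) * inverse (1 - cinner \<zeta> v') ^ CARD('n)) \<partial>sphere_measure)"
    by (simp add: power_mult_distrib mult_ac)
  also have "\<dots> = inverse (a * cnj b) ^ CARD('n) * (of_real (sphere_area CARD('n)) * inverse (1 - cinner u' v') ^ CARD('n))"
    by (simp only: integral_mult_right_zero sphere_integral_kernel_unit[OF \<open>norm u' < 1\<close> \<open>norm v' < 1\<close>])
  also have "\<dots> = of_real (sphere_area CARD('n)) * inverse (a * cnj b * (1 - cinner u' v')) ^ CARD('n)"
    by (simp add: power_mult_distrib mult_ac)
  also have "a * cnj b * (1 - cinner u' v') = a * cnj b - cinner u v"
    using a b by (simp add: u'_def v'_def cinner_scale_left cinner_scale_right field_simps)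
  finally show ?thesis .
qed

subsection \<open>Moebius-transformed inner products\<close>

text \<open>\<open>mobius_cinner z x y\<close> is \<open>\<langle>\<phi>\<^sub>z x, \<phi>\<^sub>z y\<rangle>\<close> for the involutive automorphism \<open>\<phi>\<^sub>z\<close> of the ball
  exchanging \<open>0\<close> and \<open>z\<close>; the map \<open>\<phi>\<^sub>z\<close> itself is never needed.\<close>

definition mobius_cinner :: "complex ^ 'n \<Rightarrow> complex ^ 'n \<Rightarrow> complex ^ 'n \<Rightarrow> complex" where
  "mobius_cinner z x y = 1 - (1 - cinner z z) * (1 - cinner x y) / ((1 - cinner x z) * (1 - cinner z y))"

lemma cinner_neq_1:
  assumes "norm a < 1" "norm b \<le> 1"
  shows "cinner a b \<noteq> 1" "cinner b a \<noteq> 1"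
proof -
  have "norm a * norm b < 1" using assms mult_left_mono[of "norm b" 1 "norm a"] by simp
  then show "cinner a b \<noteq> 1" "cinner b a \<noteq> 1"
    using norm_cinner_le[of a b] norm_cinner_le[of b a] by (auto simp: mult.commute)
qed

lemma cnj_mobius_cinner: "cnj (mobius_cinner z x y) = mobius_cinner z y x"
  by (simp add: mobius_cinner_def cnj_cinner mult.commute)

lemma mobius_cinner_self:
  "mobius_cinner z x x = of_real (1 - (1 - (norm z)\<^sup>2) * (1 - (norm x)\<^sup>2) / (norm (1 - cinner z x))\<^sup>2)"
proof -
  have "(1 - cinner x z) * (1 - cinner z x) = of_real ((norm (1 - cinner z x))\<^sup>2)"
    by (subst complex_norm_square) (simp add: cnj_cinner mult.commute)
  then show ?thesis by (simp add: mobius_cinner_def cinner_self)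
qed

text \<open>With \<open>b = 1 - \<langle>z, \<zeta>\<rangle>\<close>, \<open>e = 1 - \<langle>x, \<zeta>\<rangle>\<close> one has \<open>e - b = \<langle>e z - b x, \<zeta>\<rangle>\<close>, and the claim is the
  Cauchy-Schwarz inequality for this inner product.\<close>

lemma norm_mobius_cinner_le:
  fixes z x \<zeta> :: "complex ^ 'n"
  assumes z: "norm z < 1" and x: "norm x < 1" and \<zeta>: "norm \<zeta> = 1"
  shows "(norm (mobius_cinner z x \<zeta>))\<^sup>2 \<le> Re (mobius_cinner z x x)"
proof -
  define b e a where "b = 1 - cinner z \<zeta>" and "e = 1 - cinner x \<zeta>" and "a = 1 - cinner x z"
  define Z X where "Z = 1 - (norm z)\<^sup>2" and "X = 1 - (norm x)\<^sup>2"
  have nz: "a \<noteq> 0" "b \<noteq> 0" using cinner_neq_1[of z \<zeta>] cinner_neq_1[of x z] z x \<zeta> by (auto simp: a_def b_def)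
  have Z: "0 < Z" using z by (simp add: Z_def power_less_one_iff)
  define u where "u = e *s z - b *s x"
  have "e - b = cinner u \<zeta>"
    unfolding u_def cinner_diff_left cinner_scale_left by (simp add: e_def b_def algebra_simps)
  then have cs: "(norm (e - b))\<^sup>2 \<le> (norm u)\<^sup>2"
    using norm_cinner_le[of u \<zeta>] \<zeta> by (intro power_mono) auto
  \<comment> \<open>In the difference the squared moduli of e and b acquire the factors -Z and -X,
    while the mixed terms combine through 1 - <z,x> = \<open>cnj a\<close>.\<close>
  have "complex_of_real ((norm u)\<^sup>2 - (norm (e - b))\<^sup>2)
      = e * cnj b * cnj a + b * cnj e * a - of_real (Z * (norm e)\<^sup>2 + X * (norm b)\<^sup>2)"
    unfolding of_real_diff of_real_add of_real_mult cinner_self[symmetric] complex_norm_square Z_def X_def of_real_1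
    by (simp add: u_def cinner_diff_left cinner_diff_right cinner_scale_left cinner_scale_right a_def
        cnj_cinner algebra_simps)
  also have "e * cnj b * cnj a + b * cnj e * a = of_real (2 * Re (e * cnj a * cnj b))"
    using complex_add_cnj[of "e * cnj a * cnj b"] by (simp add: mult_ac)
  finally have "complex_of_real ((norm u)\<^sup>2 - (norm (e - b))\<^sup>2)
      = of_real (2 * Re (e * cnj a * cnj b) - (Z * (norm e)\<^sup>2 + X * (norm b)\<^sup>2))" by simp
  then have main: "Z * (norm e)\<^sup>2 + X * (norm b)\<^sup>2 \<le> 2 * Re (e * cnj a * cnj b)"
    using cs unfolding of_real_eq_iff by linarith
  have sq: "(norm (1 - of_real c * v))\<^sup>2 = 1 - 2 * c * Re v + c\<^sup>2 * (norm v)\<^sup>2" for c :: real and v :: complex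
    unfolding cmod_power2 by (simp add: power2_eq_square algebra_simps)
  define N where "N = (norm a)\<^sup>2 * (norm b)\<^sup>2"
  have N: "0 < N" using nz by (simp add: N_def)
  have "mobius_cinner z x \<zeta> = 1 - of_real (Z / N) * (e * cnj a * cnj b)"
  proof -
    have "of_real N = a * cnj a * (b * cnj b)" by (simp add: N_def complex_norm_square[symmetric])
    then have "of_real Z * e / (a * b) = of_real Z / of_real N * (e * cnj a * cnj b)"
      using nz by (simp add: field_simps)
    then show ?thesis
      by (simp add: mobius_cinner_def cinner_self Z_def a_def b_def e_def)
  qed
  then have "(norm (mobius_cinner z x \<zeta>))\<^sup>2 = 1 - 2 * (Z / N) * Re (e * cnj a * cnj b) + (Z / N)\<^sup>2 * (norm (e * cnj a * cnj b))\<^sup>2"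
    by (simp only: sq)
  also have "(norm (e * cnj a * cnj b))\<^sup>2 = N * (norm e)\<^sup>2"
    by (simp add: N_def norm_mult power_mult_distrib mult_ac)
  also have "1 - 2 * (Z / N) * Re (e * cnj a * cnj b) + (Z / N)\<^sup>2 * (N * (norm e)\<^sup>2)
      = 1 - Z / N * (2 * Re (e * cnj a * cnj b) - Z * (norm e)\<^sup>2)"
    using N by (simp add: field_simps power2_eq_square)
  also have "\<dots> \<le> 1 - Z / N * (X * (norm b)\<^sup>2)"
    using main Z N by (simp add: mult_left_mono divide_right_mono)
  also have "\<dots> = Re (mobius_cinner z x x)"
  proof -
    have "norm (1 - cinner z x) = norm a"
      unfolding a_def using complex_mod_cnj[of "1 - cinner x z"] by (simp add: cnj_cinner)
    then show ?thesis
      unfolding mobius_cinner_self using nz by (simp add: Z_def X_def N_def)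
  qed
  finally show ?thesis .
qed

lemma mobius_cinner_self_bounds:
  fixes z x :: "complex ^ 'n"
  assumes z: "norm z < 1" and x: "norm x < 1"
  shows "0 \<le> Re (mobius_cinner z x x)" "Re (mobius_cinner z x x) < 1"
proof -
  \<comment> \<open>Any unit vector will do: the preceding inequality then bounds the real part
    below by a square.\<close>
  have "norm (axis undefined 1 :: complex ^ 'n) = 1" by simp
  from norm_mobius_cinner_le[OF z x this] show "0 \<le> Re (mobius_cinner z x x)"
    by (rule order_trans[rotated]) simp
  have "0 < (1 - (norm z)\<^sup>2) * (1 - (norm x)\<^sup>2) / (norm (1 - cinner z x))\<^sup>2"
    using z x cinner_neq_1[of z x] by (simp add: power_less_one_iff)
  then show "Re (mobius_cinner z x x) < 1" unfolding mobius_cinner_self by simp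
qed

lemma norm_mobius_cinner_le_sqrt:
  fixes z x \<zeta> :: "complex ^ 'n"
  assumes "norm z < 1" "norm x < 1" "norm \<zeta> = 1"
  shows "norm (mobius_cinner z x \<zeta>) \<le> sqrt (Re (mobius_cinner z x x))"
  using norm_mobius_cinner_le[OF assms] by (rule real_le_rsqrt)

lemma norm_mobius_cinner_le_1:
  fixes z x \<zeta> :: "complex ^ 'n"
  assumes "norm z < 1" "norm x < 1" "norm \<zeta> = 1"
  shows "norm (mobius_cinner z x \<zeta>) \<le> 1"
  using norm_mobius_cinner_le_sqrt[OF assms] mobius_cinner_self_bounds[OF assms(1,2)]
  by (meson less_imp_le order_trans real_sqrt_le_1_iff)

lemma borel_measurable_cnj [measurable]: "cnj \<in> borel_measurable borel"
  by (intro borel_measurable_continuous_onI continuous_intros)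

lemma borel_measurable_mobius_cinner [measurable]: "mobius_cinner z x \<in> borel_measurable borel"
  unfolding mobius_cinner_def[abs_def] by measurable

text \<open>The Jacobian of the involution on the sphere, that is, the Poisson kernel without its
  constant. The two conjugate powers are kept apart because one cancels the denominator of a pencil
  and the other that of a conjugated pencil.\<close>

definition poisson_weight :: "complex ^ 'n \<Rightarrow> complex ^ 'n \<Rightarrow> complex" where
  "poisson_weight z \<zeta> = (1 - cinner z z) ^ CARD('n) * (inverse (1 - cinner z \<zeta>) ^ CARD('n) * inverse (1 - cinner \<zeta> z) ^ CARD('n))"

lemma borel_measurable_poisson_weight [measurable]: "poisson_weight z \<in> borel_measurable borel"
  unfolding poisson_weight_def[abs_def] by measurable

lemma norm_poisson_weight_le:
  fixes z \<zeta> :: "complex ^ 'n"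
  assumes z: "norm z < 1" and \<zeta>: "norm \<zeta> = 1"
  shows "norm (poisson_weight z \<zeta>) \<le> norm (1 - cinner z z) ^ CARD('n) * (inverse (1 - norm z) ^ CARD('n) * inverse (1 - norm z) ^ CARD('n))"
  unfolding poisson_weight_def norm_mult norm_power[of "1 - cinner z z"]
  using norm_cinner_le[of z \<zeta>] norm_cinner_le[of \<zeta> z] z \<zeta>
  by (intro mult_mono mult_left_mono norm_inverse_one_minus_le) (auto simp: mult.commute)

section \<open>Moments of pencils of transformed inner products\<close>

definition mobius_factor :: "complex ^ 'n \<Rightarrow> complex ^ 'n \<Rightarrow> complex" where
  "mobius_factor z x = (1 - cinner z z) / (1 - cinner x z)"

context
  fixes z x y :: "complex ^ 'n"
begin

text \<open>With f = \<open>mobius_factor z x\<close>, \<open>mobius_cinner z x \<zeta>\<close> has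
  numerator (1 - f) - <z - f x, \<zeta>> over the denominator 1 - <z,\<zeta>>. Constant and vector
  of the pencil are those of the denominator minus s and t times those of the numerators for x and
  y.\<close>

definition pencil_const where "pencil_const s t = 1 - (s * (1 - mobius_factor z x) + t * (1 - mobius_factor z y))"
definition pencil_vec where "pencil_vec s t = z - (s *s (z - mobius_factor z x *s x) + t *s (z - mobius_factor z y *s y))"
definition mobius_pencil where "mobius_pencil s t \<zeta> = s * mobius_cinner z x \<zeta> + t * mobius_cinner z y \<zeta>"
text \<open>The Hermitian product of s \<phi>(x) + t \<phi>(y) with s' \<phi>(x) + t'
  \<phi>(y).\<close>

definition pencil_gram where "pencil_gram s t s' t' = s * cnj s' * mobius_cinner z x x + s * cnj t' * mobius_cinner z x y
    + t * cnj s' * mobius_cinner z y x + t * cnj t' * mobius_cinner z y y"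

context
  assumes z: "norm z < 1" and x: "norm x < 1" and y: "norm y < 1"
begin

text \<open>On the sphere, \<open>s \<langle>\<phi>\<^sub>z x, \<phi>\<^sub>z \<zeta>\<rangle> + t \<langle>\<phi>\<^sub>z y, \<phi>\<^sub>z \<zeta>\<rangle>\<close> is a quotient of affine functions whose denominator is
  exactly the one that occurs in the Poisson kernel.\<close>

lemma one_minus_mobius_pencil: "norm \<zeta> \<le> 1 \<Longrightarrow> 1 - mobius_pencil s t \<zeta> = (pencil_const s t - cinner (pencil_vec s t) \<zeta>) / (1 - cinner z \<zeta>)"
  using cinner_neq_1[of z \<zeta>] cinner_neq_1[of x z] cinner_neq_1[of y z] z x y
  by (simp add: mobius_pencil_def pencil_const_def pencil_vec_def mobius_cinner_def cinner_diff_left cinner_add_left cinner_scale_left divide_simps mobius_factor_def)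
    (simp add: algebra_simps)

text \<open>Pair affine data by the indefinite form (\<alpha>, U), (\<beta>, V) \<mapsto> \<alpha>
  \<open>cnj\<close> \<beta> - <U,V>. The denominator (1, z) has self-pairing Z = 1 - <z,z> and is
  orthogonal to every numerator (1 - f, z - f x); two numerators pair to -Z times the transformed
  inner product. Bilinear expansion then leaves Z minus Z times the Gram form.\<close>

lemma pencil_pairing: "pencil_const s t * cnj (pencil_const s' t') - cinner (pencil_vec s t) (pencil_vec s' t') = (1 - cinner z z) * (1 - pencil_gram s t s' t')"
proof -
  define Z where "Z = 1 - cinner z z"
  have Z: "Z \<noteq> 0" using cinner_neq_1[of z z] z by (simp add: Z_def)
  have fx: "(mobius_factor z x) * (1 - cinner x z) = Z" and fy: "(mobius_factor z y) * (1 - cinner y z) = Z"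
    using cinner_neq_1[of x z] cinner_neq_1[of y z] x y z by (auto simp: mobius_factor_def Z_def)
  from arg_cong[OF fx, of cnj] arg_cong[OF fy, of cnj]
  have cfx: "cnj (mobius_factor z x) * (1 - cinner z x) = Z" and cfy: "cnj (mobius_factor z y) * (1 - cinner z y) = Z"
    by (simp_all add: cnj_cinner Z_def)
  have pair: "(1 - k) * (1 - k') - cinner (z - k *s a) (z - cnj k' *s b) = - Z + k * k' * (1 - cinner a b)"
    if "k * (1 - cinner a z) = Z" "k' * (1 - cinner z b) = Z" for k k' a b
    using that by (simp add: cinner_diff_left cinner_diff_right cinner_scale_left cinner_scale_right Z_def algebra_simps)
  have orth: "(1 - k) - cinner (z - k *s a) z = 0" if "k * (1 - cinner a z) = Z" for k a
    using that by (simp add: cinner_diff_left cinner_scale_left Z_def algebra_simps)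
  have orth': "(1 - k) - cinner z (z - cnj k *s a) = 0" if "k * (1 - cinner z a) = Z" for k a
    using that by (simp add: cinner_diff_right cinner_scale_right Z_def algebra_simps)
  have mob: "Z * mobius_cinner z a b = Z - k * k' * (1 - cinner a b)"
    if "k * (1 - cinner a z) = Z" "k' * (1 - cinner z b) = Z" for k k' a b
  proof -
    have "1 - cinner a z \<noteq> 0" "1 - cinner z b \<noteq> 0" using that Z by auto
    then have "k = Z / (1 - cinner a z)" "k' = Z / (1 - cinner z b)" using that by (auto simp: eq_divide_eq)
    then show ?thesis by (simp add: mobius_cinner_def Z_def[symmetric] algebra_simps)
  qed
  define U V where "U = z - mobius_factor z x *s x" and "V = z - mobius_factor z y *s y"
  have o: "cinner U z = 1 - mobius_factor z x" "cinner V z = 1 - mobius_factor z y" "cinner z U = 1 - cnj (mobius_factor z x)" "cinner z V = 1 - cnj (mobius_factor z y)"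
    using orth[OF fx] orth[OF fy] orth'[OF cfx] orth'[OF cfy] by (simp_all add: U_def V_def)
  have p: "cinner U U = (1 - mobius_factor z x) * (1 - cnj (mobius_factor z x)) + Z * mobius_cinner z x x"
    "cinner U V = (1 - mobius_factor z x) * (1 - cnj (mobius_factor z y)) + Z * mobius_cinner z x y"
    "cinner V U = (1 - mobius_factor z y) * (1 - cnj (mobius_factor z x)) + Z * mobius_cinner z y x"
    "cinner V V = (1 - mobius_factor z y) * (1 - cnj (mobius_factor z y)) + Z * mobius_cinner z y y"
    using pair[OF fx cfx] pair[OF fx cfy] pair[OF fy cfx] pair[OF fy cfy]
    unfolding mob[OF fx cfx] mob[OF fx cfy] mob[OF fy cfx] mob[OF fy cfy]
    by (simp_all add: U_def V_def algebra_simps)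
  have "cinner (pencil_vec s t) (pencil_vec s' t') = cinner z z - (s * cinner U z + t * cinner V z)
      - (cnj s' * cinner z U + cnj t' * cinner z V)
      + (s * cnj s' * cinner U U + s * cnj t' * cinner U V + t * cnj s' * cinner V U + t * cnj t' * cinner V V)"
    unfolding pencil_vec_def U_def[symmetric] V_def[symmetric]
    by (simp add: cinner_diff_left cinner_diff_right cinner_add_left cinner_add_right cinner_scale_left cinner_scale_right algebra_simps)
  then show ?thesis
    unfolding o p pencil_const_def pencil_gram_def Z_def[symmetric] by (simp add: Z_def algebra_simps)
qed

text \<open>The factor 1 - <z,z> in the weight is exactly the one produced by
  \<open>pencil_pairing\<close>, so the two powers of it cancel and no trace of z remains outside
  the Gram form. The series and the Szego formula are available for small coefficients only; the
  pencils are therefore shrunk by \<epsilon>, which homogeneity divides out at the end.\<close>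

lemma mobius_moments:
  "(\<integral>\<zeta>. poisson_weight z \<zeta> * mobius_pencil s t \<zeta> ^ k * cnj (mobius_pencil s' t' \<zeta>) ^ l \<partial>sphere_measure)
    = (if k = l then of_real (sphere_area CARD('n)) * fact k / pochhammer (of_nat CARD('n)) k * pencil_gram s t s' t' ^ k else 0)"
proof -
  define n where "n = CARD('n)"
  define Z where "Z = 1 - cinner z z"
  have Z: "Z \<noteq> 0" using cinner_neq_1[of z z] z by (simp add: Z_def)
  \<comment> \<open>\<open>M\<close> bounds how far the pencil moves the constant from 1 and the
    vector from z. \<open>R\<close> adds up everything \<epsilon> has to control, so that \<epsilon>
    times any of its summands is at most a quarter of the gap 1 - norm z.\<close>
  define M where "M s t = norm s * (norm (z - mobius_factor z x *s x) + norm (1 - mobius_factor z x)) + norm t * (norm (z - mobius_factor z y *s y) + norm (1 - mobius_factor z y))" for s t :: complex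
  define R where "R = 1 + M s t + M s' t' + norm s + norm t + norm s' + norm t' + norm (pencil_gram s t s' t')"
  define \<epsilon> where "\<epsilon> = (1 - norm z) / (4 * R)"
  have Mnn: "0 \<le> M s t" for s t by (simp add: M_def)
  have R: "1 \<le> R" using Mnn[of s t] Mnn[of s' t'] by (simp add: R_def)
  have \<epsilon>: "0 < \<epsilon>" using z R by (simp add: \<epsilon>_def)
  have \<epsilon>R: "\<epsilon> * R = (1 - norm z) / 4" using R by (simp add: \<epsilon>_def)
  have \<epsilon>_le: "\<epsilon> * r \<le> (1 - norm z) / 4" if "r \<le> R" for r
    using mult_left_mono[OF that, of \<epsilon>] \<epsilon> \<epsilon>R by simp
  have eM: "\<epsilon> * M s t \<le> (1 - norm z) / 4" "\<epsilon> * M s' t' \<le> (1 - norm z) / 4"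
    using Mnn[of s t] Mnn[of s' t'] by (intro \<epsilon>_le; simp add: R_def)+
  have eg: "\<epsilon> * (norm s + norm t) \<le> (1 - norm z) / 4" "\<epsilon> * (norm s' + norm t') \<le> (1 - norm z) / 4"
    using Mnn[of s t] Mnn[of s' t'] by (intro \<epsilon>_le; simp add: R_def)+
  have eH: "\<epsilon> * norm (pencil_gram s t s' t') \<le> (1 - norm z) / 4"
    using Mnn[of s t] Mnn[of s' t'] by (intro \<epsilon>_le; simp add: R_def)+
  have "\<epsilon> * 1 \<le> (1 - norm z) / 4" using R by (intro \<epsilon>_le)
  then have \<epsilon>1: "\<epsilon> < 1" using norm_ge_zero[of z] unfolding mult_1_right by argo
  \<comment> \<open>A quarter of the gap is lost on each side: the vector has norm at most norm z +
    gap / 4, and this is less than 1 - gap / 4, a lower bound for the constant.\<close>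
  have kernel_ok: "norm (pencil_vec (c * s) (c * t)) < norm (pencil_const (c * s) (c * t))"
    if c: "norm c \<le> \<epsilon>" and st: "\<epsilon> * M s t \<le> (1 - norm z) / 4" for c s t
  proof -
    have cM: "norm c * M s t \<le> (1 - norm z) / 4"
      using mult_right_mono[OF c Mnn[of s t]] st by simp
    have "norm (pencil_vec (c * s) (c * t)) \<le> norm z + (norm (c * s) * norm (z - mobius_factor z x *s x) + norm (c * t) * norm (z - mobius_factor z y *s y))"
      unfolding pencil_vec_def by (intro order_trans[OF norm_triangle_ineq4] add_mono order_trans[OF norm_triangle_ineq])
        (simp_all only: norm_scale_vec order_refl)
    also have "\<dots> \<le> norm z + norm c * M s t"
      by (simp add: M_def norm_mult algebra_simps)
    finally have 1: "norm (pencil_vec (c * s) (c * t)) \<le> norm z + (1 - norm z) / 4" using cM by argo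
    have "norm (c * s * (1 - mobius_factor z x) + c * t * (1 - mobius_factor z y)) \<le> norm c * M s t"
      by (rule order_trans[OF norm_triangle_ineq]) (simp add: M_def norm_mult distrib_left mult.assoc)
    then have "1 - (1 - norm z) / 4 \<le> norm (pencil_const (c * s) (c * t))"
      unfolding pencil_const_def using norm_triangle_ineq2[of 1 "c * s * (1 - mobius_factor z x) + c * t * (1 - mobius_factor z y)"] cM
      unfolding norm_one by argo
    with 1 z show ?thesis by argo
  qed
  have g_small: "norm (mobius_pencil (c * s) (c * t) \<zeta>) \<le> 1 / 4"
    if c: "norm c \<le> \<epsilon>" and st: "\<epsilon> * (norm s + norm t) \<le> (1 - norm z) / 4" and \<zeta>: "norm \<zeta> = 1" for c s t \<zeta>
  proof -
    have "norm (mobius_pencil (c * s) (c * t) \<zeta>) \<le> norm (c * s) * 1 + norm (c * t) * 1"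
      unfolding mobius_pencil_def
      by (intro order_trans[OF norm_triangle_ineq] add_mono) (auto simp only: norm_mult intro!: mult_left_mono norm_mobius_cinner_le_1[OF z _ \<zeta>] x y mult_nonneg_nonneg norm_ge_zero)
    also have "\<dots> = norm c * (norm s + norm t)" by (simp add: norm_mult algebra_simps)
    also have "\<dots> \<le> \<epsilon> * (norm s + norm t)" using c by (intro mult_right_mono) auto
    also have "\<dots> \<le> 1 / 4" using st norm_ge_zero[of z] by argo
    finally show ?thesis .
  qed
  have scale: "mobius_pencil (c * s) (c * t) \<zeta> = c * mobius_pencil s t \<zeta>" for c s t \<zeta> by (simp add: mobius_pencil_def algebra_simps)
  have meas[measurable]: "mobius_pencil s t \<in> borel_measurable borel" for s t unfolding mobius_pencil_def by measurable
  have cf: "neg_binomial_coeff n k * neg_binomial_coeff n l * (\<integral>\<zeta>. poisson_weight z \<zeta> * (of_real \<epsilon> * mobius_pencil s t \<zeta>) ^ k * (of_real \<epsilon> * cnj (mobius_pencil s' t' \<zeta>)) ^ l \<partial>sphere_measure)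
      = (if k = l then of_real (sphere_area n) * neg_binomial_coeff n k * (of_real (\<epsilon>\<^sup>2) * pencil_gram s t s' t') ^ k else 0)" for k l
  proof (rule moments_from_generating_function[where c="neg_binomial_coeff n"
        and d="\<lambda>k. of_real (sphere_area n) * neg_binomial_coeff n k * (of_real (\<epsilon>\<^sup>2) * pencil_gram s t s' t') ^ k"])
    interpret finite_measure "sphere_measure :: (complex ^ 'n) measure" by (rule finite_measure_sphere_measure)
    have sm: "norm (of_real \<epsilon> * mobius_pencil s t \<zeta>) \<le> 1/4" "norm (of_real \<epsilon> * cnj (mobius_pencil s' t' \<zeta>)) \<le> 1/4" if "norm \<zeta> = 1" for \<zeta>
      using g_small[OF _ eg(1) that, of "of_real \<epsilon>"] g_small[OF _ eg(2) that, of "of_real \<epsilon>"] \<epsilon>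
      by (auto simp: scale norm_mult)
    show "AE \<zeta> in sphere_measure. summable (\<lambda>k. norm (neg_binomial_coeff n k :: complex) * norm (of_real \<epsilon> * mobius_pencil s t \<zeta>) ^ k)"
      using AE_sphere_measure by eventually_elim (rule neg_binomial_suminf_le(1)[OF sm(1)]; simp)
    show "AE \<zeta> in sphere_measure. summable (\<lambda>k. norm (neg_binomial_coeff n k :: complex) * norm (of_real \<epsilon> * cnj (mobius_pencil s' t' \<zeta>)) ^ k)"
      using AE_sphere_measure by eventually_elim (rule neg_binomial_suminf_le(1)[OF sm(2)]; simp)
    let ?P = "norm (1 - cinner z z) ^ CARD('n) * (inverse (1 - norm z) ^ CARD('n) * inverse (1 - norm z) ^ CARD('n))"
    let ?B = "\<Sum>k. neg_binomial_coeff n k * (1/4 :: real) ^ k"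
    show "integrable sphere_measure (\<lambda>\<zeta>. norm (poisson_weight z \<zeta>) *
        (\<Sum>k. norm (neg_binomial_coeff n k :: complex) * norm (of_real \<epsilon> * mobius_pencil s t \<zeta>) ^ k) *
        (\<Sum>k. norm (neg_binomial_coeff n k :: complex) * norm (of_real \<epsilon> * cnj (mobius_pencil s' t' \<zeta>)) ^ k))"
    proof (rule integrable_const_bound[where B="?P * ?B * ?B"])
      show "AE \<zeta> in sphere_measure. norm (norm (poisson_weight z \<zeta>) *
        (\<Sum>k. norm (neg_binomial_coeff n k :: complex) * norm (of_real \<epsilon> * mobius_pencil s t \<zeta>) ^ k) *
        (\<Sum>k. norm (neg_binomial_coeff n k :: complex) * norm (of_real \<epsilon> * cnj (mobius_pencil s' t' \<zeta>)) ^ k)) \<le> ?P * ?B * ?B"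
        using AE_sphere_measure
      proof eventually_elim
        case (elim \<zeta>)
        have quarter: "(1/4 :: real) < 1" by simp
        have nn: "0 \<le> (\<Sum>k. norm (neg_binomial_coeff n k :: complex) * norm (of_real \<epsilon> * mobius_pencil s t \<zeta>) ^ k)"
          "0 \<le> (\<Sum>k. norm (neg_binomial_coeff n k :: complex) * norm (of_real \<epsilon> * cnj (mobius_pencil s' t' \<zeta>)) ^ k)"
          by (rule suminf_nonneg[OF neg_binomial_suminf_le(1)[OF sm(1)[OF elim] quarter]], simp,
              rule suminf_nonneg[OF neg_binomial_suminf_le(1)[OF sm(2)[OF elim] quarter]], simp)
        note le = neg_binomial_suminf_le(2)[OF sm(1)[OF elim] quarter] neg_binomial_suminf_le(2)[OF sm(2)[OF elim] quarter]
        have "0 \<le> ?B" using nn(1) le(1) by (rule order_trans)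
        moreover have "0 \<le> ?P" using norm_poisson_weight_le[OF z elim] norm_ge_zero by (rule order_trans[rotated])
        ultimately show ?case
          unfolding real_norm_def abs_mult abs_norm_cancel abs_of_nonneg[OF nn(1)] abs_of_nonneg[OF nn(2)]
          by (intro mult_mono le norm_poisson_weight_le[OF z elim] mult_nonneg_nonneg nn norm_ge_zero) (use z in auto)
      qed
    qed measurable
    fix \<sigma> \<tau> :: complex
    assume \<sigma>: "norm \<sigma> < 1" and \<tau>: "norm \<tau> < 1"
    \<comment> \<open>The second pencil enters through its conjugate, so its coefficient has to be
      \<open>cnj \<tau>\<close> for \<tau> itself to appear in the product.\<close>
    define a b where "a = \<sigma> * of_real \<epsilon>" and "b = cnj \<tau> * of_real \<epsilon>"
    have a: "norm a \<le> \<epsilon>" and b: "norm b \<le> \<epsilon>"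
      using \<sigma> \<tau> \<epsilon> by (auto simp: a_def b_def norm_mult mult_le_cancel_right1)
    have H: "pencil_gram (a * s) (a * t) (b * s') (b * t') = of_real (\<epsilon>\<^sup>2) * pencil_gram s t s' t' * (\<sigma> * \<tau>)"
      by (simp add: pencil_gram_def a_def b_def power2_eq_square algebra_simps)
    have "(\<integral>\<zeta>. poisson_weight z \<zeta> * (\<Sum>k. neg_binomial_coeff n k * (\<sigma> * (of_real \<epsilon> * mobius_pencil s t \<zeta>)) ^ k)
        * (\<Sum>k. neg_binomial_coeff n k * (\<tau> * (of_real \<epsilon> * cnj (mobius_pencil s' t' \<zeta>))) ^ k) \<partial>sphere_measure)
      = (\<integral>\<zeta>. Z ^ n * (inverse (pencil_const (a * s) (a * t) - cinner (pencil_vec (a * s) (a * t)) \<zeta>) ^ n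
          * inverse (cnj (pencil_const (b * s') (b * t')) - cinner \<zeta> (pencil_vec (b * s') (b * t'))) ^ n) \<partial>sphere_measure)"
    proof (rule integral_cong_AE)
      show "AE \<zeta> in sphere_measure. poisson_weight z \<zeta> * (\<Sum>k. neg_binomial_coeff n k * (\<sigma> * (of_real \<epsilon> * mobius_pencil s t \<zeta>)) ^ k)
          * (\<Sum>k. neg_binomial_coeff n k * (\<tau> * (of_real \<epsilon> * cnj (mobius_pencil s' t' \<zeta>))) ^ k)
        = Z ^ n * (inverse (pencil_const (a * s) (a * t) - cinner (pencil_vec (a * s) (a * t)) \<zeta>) ^ n
          * inverse (cnj (pencil_const (b * s') (b * t')) - cinner \<zeta> (pencil_vec (b * s') (b * t'))) ^ n)"
        using AE_sphere_measure
      proof eventually_elim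
        case (elim \<zeta>)
        have A: "\<sigma> * (of_real \<epsilon> * mobius_pencil s t \<zeta>) = mobius_pencil (a * s) (a * t) \<zeta>"
          and B: "\<tau> * (of_real \<epsilon> * cnj (mobius_pencil s' t' \<zeta>)) = cnj (mobius_pencil (b * s') (b * t') \<zeta>)"
          by (simp_all add: scale a_def b_def)
        have sums: "(\<Sum>k. neg_binomial_coeff n k * u ^ k) = inverse (1 - u) ^ n" if "norm u \<le> 1/4" for u :: complex
          using neg_binomial_sums[of u n] that by (simp add: sums_iff)
        have S1: "(\<Sum>k. neg_binomial_coeff n k * mobius_pencil (a * s) (a * t) \<zeta> ^ k) = inverse (1 - mobius_pencil (a * s) (a * t) \<zeta>) ^ n"
          by (rule sums[OF g_small[OF a eg(1) elim]])
        have S2: "(\<Sum>k. neg_binomial_coeff n k * cnj (mobius_pencil (b * s') (b * t') \<zeta>) ^ k) = cnj (inverse (1 - mobius_pencil (b * s') (b * t') \<zeta>) ^ n)"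
          using sums[of "cnj (mobius_pencil (b * s') (b * t') \<zeta>)"] g_small[OF b eg(2) elim] by simp
        have nz: "1 - cinner z \<zeta> \<noteq> 0" "1 - cinner \<zeta> z \<noteq> 0" using cinner_neq_1[of z \<zeta>] z elim by auto
        have cancel: "c * (inverse u * inverse v) * (P * u) * (Q * v) = c * (P * Q)"
          if "u \<noteq> 0" "v \<noteq> 0" for c u v P Q :: complex
          using that by (simp add: field_simps)
        show ?case
          unfolding A B S1 S2 using elim nz
          by (simp add: cancel one_minus_mobius_pencil poisson_weight_def Z_def n_def cnj_cinner power_mult_distrib[symmetric] divide_inverse)
      qed
    qed (unfold pencil_vec_def, measurable)
    also have "\<dots> = Z ^ n * (of_real (sphere_area n) * inverse (Z * (1 - pencil_gram (a * s) (a * t) (b * s') (b * t'))) ^ n)"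
      unfolding n_def Z_def integral_mult_right_zero
        sphere_integral_kernel[OF kernel_ok[OF a eM(1)] kernel_ok[OF b eM(2)]] pencil_pairing ..
    also have "\<dots> = of_real (sphere_area n) * inverse (1 - of_real (\<epsilon>\<^sup>2) * pencil_gram s t s' t' * (\<sigma> * \<tau>)) ^ n"
      unfolding H using Z by (simp add: power_mult_distrib power_inverse)
    finally have eq: "(\<integral>\<zeta>. poisson_weight z \<zeta> * (\<Sum>k. neg_binomial_coeff n k * (\<sigma> * (of_real \<epsilon> * mobius_pencil s t \<zeta>)) ^ k)
        * (\<Sum>k. neg_binomial_coeff n k * (\<tau> * (of_real \<epsilon> * cnj (mobius_pencil s' t' \<zeta>))) ^ k) \<partial>sphere_measure)
      = of_real (sphere_area n) * inverse (1 - of_real (\<epsilon>\<^sup>2) * pencil_gram s t s' t' * (\<sigma> * \<tau>)) ^ n" .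
    have "norm (of_real (\<epsilon>\<^sup>2) * pencil_gram s t s' t' * (\<sigma> * \<tau>)) < 1"
    proof -
      have "norm (of_real (\<epsilon>\<^sup>2) * pencil_gram s t s' t' * (\<sigma> * \<tau>)) = \<epsilon> * (\<epsilon> * norm (pencil_gram s t s' t')) * (norm \<sigma> * norm \<tau>)"
        using \<epsilon> by (simp add: norm_mult power2_eq_square norm_power)
      also have "\<dots> \<le> 1 * ((1 - norm z) / 4) * (1 * 1)"
        using \<epsilon> \<epsilon>1 \<sigma> \<tau> eH z by (intro mult_mono mult_nonneg_nonneg) auto
      also have "\<dots> < 1" using norm_ge_zero[of z] by argo
      finally show ?thesis .
    qed
    from sums_mult[OF neg_binomial_sums[OF this, of n], of "of_real (sphere_area n)"]
    show "(\<lambda>k. of_real (sphere_area n) * neg_binomial_coeff n k * (of_real (\<epsilon>\<^sup>2) * pencil_gram s t s' t') ^ k * (\<sigma> * \<tau>) ^ k) sums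
        (\<integral>\<zeta>. poisson_weight z \<zeta> * (\<Sum>k. neg_binomial_coeff n k * (\<sigma> * (of_real \<epsilon> * mobius_pencil s t \<zeta>)) ^ k)
        * (\<Sum>k. neg_binomial_coeff n k * (\<tau> * (of_real \<epsilon> * cnj (mobius_pencil s' t' \<zeta>))) ^ k) \<partial>sphere_measure)"
      unfolding eq by (simp add: power_mult_distrib mult_ac)
  qed measurable
  define I where "I = (\<integral>\<zeta>. poisson_weight z \<zeta> * mobius_pencil s t \<zeta> ^ k * cnj (mobius_pencil s' t' \<zeta>) ^ l \<partial>sphere_measure)"
  have "(\<integral>\<zeta>. poisson_weight z \<zeta> * (of_real \<epsilon> * mobius_pencil s t \<zeta>) ^ k * (of_real \<epsilon> * cnj (mobius_pencil s' t' \<zeta>)) ^ l \<partial>sphere_measure)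
     = (\<integral>\<zeta>. of_real (\<epsilon> ^ (k + l)) * (poisson_weight z \<zeta> * mobius_pencil s t \<zeta> ^ k * cnj (mobius_pencil s' t' \<zeta>) ^ l) \<partial>sphere_measure)"
    by (simp add: power_mult_distrib power_add mult_ac)
  also have "\<dots> = of_real (\<epsilon> ^ (k + l)) * I" unfolding I_def by (rule integral_mult_right_zero)
  finally have eq: "neg_binomial_coeff n k * neg_binomial_coeff n l * (of_real (\<epsilon> ^ (k + l)) * I)
      = (if k = l then of_real (sphere_area n) * neg_binomial_coeff n k * (of_real (\<epsilon>\<^sup>2) * pencil_gram s t s' t') ^ k else 0)"
    using cf[of k l] by simp
  have nz: "(neg_binomial_coeff n k :: complex) \<noteq> 0" for k
    by (simp add: neg_binomial_coeff_def n_def pochhammer_of_nat_neq_0)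
  show ?thesis
  proof (cases "k = l")
    case False
    then show ?thesis using eq nz \<epsilon> unfolding I_def[symmetric] by simp
  next
    case True
    have "neg_binomial_coeff n k * I = of_real (sphere_area n) * pencil_gram s t s' t' ^ k"
      using eq True nz[of k] \<epsilon> by (simp add: power_mult_distrib power_add power2_eq_square mult_ac)
    then have "I = of_real (sphere_area n) * pencil_gram s t s' t' ^ k / neg_binomial_coeff n k"
      using nz[of k] by (simp add: field_simps)
    then show ?thesis using True unfolding I_def[symmetric] by (simp add: neg_binomial_coeff_def n_def mult_ac)
  qed
qed

end

end

section \<open>Polarization to mixed monomials\<close>

lemma binomial_expand:
  "(s * u + v) ^ n = (\<Sum>i\<le>n. of_nat (n choose i) * s ^ i * (u ^ i * v ^ (n - i)))"
  for s u v :: "'a :: comm_semiring_1"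
  by (simp add: binomial_ring power_mult_distrib mult_ac)

text \<open>Grouped as s (r A + B) + (r B' + D), the N-th power has s^i coefficient (N choose i) (r
  A + B)^i (r B' + D)^(N - i). The binomial is nonzero and cancels; the coefficient of r^k is then a
  Cauchy product in which m counts the factors A.\<close>

lemma polarized_coefficients:
  fixes M :: "nat \<Rightarrow> nat \<Rightarrow> complex"
  assumes gen: "\<And>s r. (\<Sum>i\<le>N. \<Sum>k\<le>N'. of_nat (N choose i) * of_nat (N' choose k) * s ^ i * r ^ k * M i k)
      = (if N = N' then K * (s * r * A + s * B + r * B' + D) ^ N else 0)"
    and i: "i \<le> N" and k: "k \<le> N'"
  shows "of_nat (N' choose k) * M i k = (if N = N' then K * (\<Sum>m\<le>k. (of_nat (i choose m) * A ^ m * B ^ (i - m)) *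
      (of_nat ((N - i) choose (k - m)) * B' ^ (k - m) * D ^ (N - i - (k - m)))) else 0)"
proof -
  define Q where "Q i r = (if N = N' then K * ((r * A + B) ^ i * (r * B' + D) ^ (N - i)) else 0)" for i r
  have poly: "(\<Sum>i\<le>N. (of_nat (N choose i) * (\<Sum>k\<le>N'. of_nat (N' choose k) * M i k * r ^ k)) * s ^ i)
      = (\<Sum>i\<le>N. (of_nat (N choose i) * Q i r) * s ^ i)" for s r
  proof -
    have "(\<Sum>i\<le>N. (of_nat (N choose i) * (\<Sum>k\<le>N'. of_nat (N' choose k) * M i k * r ^ k)) * s ^ i)
        = (if N = N' then K * (s * r * A + s * B + r * B' + D) ^ N else 0)"
      unfolding gen[symmetric] by (simp add: sum_distrib_left sum_distrib_right mult_ac)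
    also have "s * r * A + s * B + r * B' + D = s * (r * A + B) + (r * B' + D)" by (simp add: algebra_simps)
    also have "(if N = N' then K * (s * (r * A + B) + (r * B' + D)) ^ N else 0) = (\<Sum>i\<le>N. (of_nat (N choose i) * Q i r) * s ^ i)"
      unfolding binomial_expand[of s "r * A + B" "r * B' + D"] by (simp add: Q_def sum_distrib_left mult_ac)
    finally show ?thesis .
  qed
  have "\<forall>i\<le>N. of_nat (N choose i) * (\<Sum>k\<le>N'. of_nat (N' choose k) * M i k * r ^ k) = of_nat (N choose i) * Q i r" for r
    unfolding polyfun_eq_coeffs[symmetric] using poly by blast
  then have "(\<Sum>k\<le>N'. of_nat (N' choose k) * M i k * r ^ k) = Q i r" for r
    using i by simp
  also have "Q i r = (\<Sum>k\<le>N'. (if N = N' then K * (\<Sum>m\<le>k. (of_nat (i choose m) * A ^ m * B ^ (i - m)) *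
      (of_nat ((N - i) choose (k - m)) * B' ^ (k - m) * D ^ (N - i - (k - m)))) else 0) * r ^ k)" for r
  proof (cases "N = N'")
    case True
    have "(r * A + B) ^ i * (r * B' + D) ^ (N - i)
        = (\<Sum>m\<le>i. (of_nat (i choose m) * A ^ m * B ^ (i - m)) * r ^ m)
          * (\<Sum>m\<le>N - i. (of_nat ((N - i) choose m) * B' ^ m * D ^ (N - i - m)) * r ^ m)"
      by (simp add: binomial_ring power_mult_distrib mult_ac)
    also have "\<dots> = (\<Sum>k\<le>i + (N - i). (\<Sum>m\<le>k. (of_nat (i choose m) * A ^ m * B ^ (i - m)) *
      (of_nat ((N - i) choose (k - m)) * B' ^ (k - m) * D ^ (N - i - (k - m)))) * r ^ k)"
      by (rule polynomial_product) (simp_all add: binomial_eq_0)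
    finally show ?thesis using True i by (simp add: Q_def sum_distrib_left mult_ac)
  qed (simp add: Q_def)
  finally have "\<forall>k\<le>N'. of_nat (N' choose k) * M i k = (if N = N' then K * (\<Sum>m\<le>k. (of_nat (i choose m) * A ^ m * B ^ (i - m)) *
      (of_nat ((N - i) choose (k - m)) * B' ^ (k - m) * D ^ (N - i - (k - m)))) else 0)"
    unfolding polyfun_eq_coeffs[symmetric] by blast
  with k show ?thesis by blast
qed

lemma integrable_sphere_bounded:
  fixes F :: "complex ^ 'n \<Rightarrow> complex"
  assumes "F \<in> borel_measurable borel" and "\<And>\<zeta>. norm \<zeta> = 1 \<Longrightarrow> norm (F \<zeta>) \<le> C"
  shows "integrable sphere_measure F"
proof -
  interpret finite_measure "sphere_measure :: (complex ^ 'n) measure" by (rule finite_measure_sphere_measure)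
  show ?thesis
    by (rule integrable_const_bound[where B=C]) (use assms AE_sphere_measure in \<open>auto elim: eventually_mono\<close>)
qed

lemma mobius_monomial_moments:
  fixes z x y :: "complex ^ 'n"
  assumes z: "norm z < 1" and x: "norm x < 1" and y: "norm y < 1"
  defines "p \<equiv> mobius_cinner z x" and "q \<equiv> mobius_cinner z y"
  defines "A \<equiv> mobius_cinner z x x" and "B \<equiv> mobius_cinner z x y" and "B' \<equiv> mobius_cinner z y x" and "D \<equiv> mobius_cinner z y y"
  shows "(\<integral>\<zeta>. poisson_weight z \<zeta> * p \<zeta> ^ i * cnj (p \<zeta>) ^ k * q \<zeta> ^ b * cnj (q \<zeta>) ^ d \<partial>sphere_measure)
    = (if i + b = k + d then of_real (sphere_area CARD('n)) * (fact k * fact d / pochhammer (of_nat CARD('n)) (i + b)) *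
        (\<Sum>m\<le>k. (of_nat (i choose m) * A ^ m * B ^ (i - m)) * (of_nat (b choose (k - m)) * B' ^ (k - m) * D ^ (b - (k - m)))) else 0)"
proof -
  define N N' where "N = i + b" and "N' = k + d"
  \<comment> \<open>The exponents of q are tied to N and N', so that one identity in s and r
    contains all these integrals at once; at the given i and k they become b and d.\<close>
  define M where "M i k = (\<integral>\<zeta>. poisson_weight z \<zeta> * p \<zeta> ^ i * cnj (p \<zeta>) ^ k * q \<zeta> ^ (N - i) * cnj (q \<zeta>) ^ (N' - k) \<partial>sphere_measure)" for i k
  define K where "K = of_real (sphere_area CARD('n)) * fact N / pochhammer (of_nat CARD('n) :: complex) N"
  have [measurable]: "p \<in> borel_measurable borel" "q \<in> borel_measurable borel" by (simp_all add: p_def q_def)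
  have p1: "norm (p \<zeta>) \<le> 1" and q1: "norm (q \<zeta>) \<le> 1" if "norm \<zeta> = 1" for \<zeta>
    using norm_mobius_cinner_le_1[OF z x that] norm_mobius_cinner_le_1[OF z y that] by (simp_all add: p_def q_def)
  define C where "C = norm (1 - cinner z z) ^ CARD('n) * (inverse (1 - norm z) ^ CARD('n) * inverse (1 - norm z) ^ CARD('n))"
  have int: "integrable sphere_measure (\<lambda>\<zeta>. poisson_weight z \<zeta> * p \<zeta> ^ i * cnj (p \<zeta>) ^ k * q \<zeta> ^ b * cnj (q \<zeta>) ^ d)" for i k b d
  proof (rule integrable_sphere_bounded[where C=C])
    fix \<zeta> :: "complex ^ 'n" assume \<zeta>: "norm \<zeta> = 1"
    have "norm (poisson_weight z \<zeta> * p \<zeta> ^ i * cnj (p \<zeta>) ^ k * q \<zeta> ^ b * cnj (q \<zeta>) ^ d) \<le> C * 1 * 1 * 1 * 1"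
      unfolding norm_mult norm_power complex_mod_cnj
      using p1[OF \<zeta>] q1[OF \<zeta>] norm_poisson_weight_le[OF z \<zeta>] norm_ge_zero[of "poisson_weight z \<zeta>"]
      unfolding C_def[symmetric] by (intro mult_mono power_le_one mult_nonneg_nonneg zero_le_power norm_ge_zero) linarith+
    then show "norm (poisson_weight z \<zeta> * p \<zeta> ^ i * cnj (p \<zeta>) ^ k * q \<zeta> ^ b * cnj (q \<zeta>) ^ d) \<le> C" by simp
  qed measurable
  have gen: "(\<Sum>i\<le>N. \<Sum>k\<le>N'. of_nat (N choose i) * of_nat (N' choose k) * s ^ i * r ^ k * M i k)
      = (if N = N' then K * (s * r * A + s * B + r * B' + D) ^ N else 0)" for s r
  proof -
    have expand: "W * (s * P + Q) ^ N * (r * P' + Q') ^ N' = (\<Sum>i\<le>N. \<Sum>k\<le>N'. of_nat (N choose i) * of_nat (N' choose k) *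
        s ^ i * r ^ k * (W * P ^ i * P' ^ k * Q ^ (N - i) * Q' ^ (N' - k)))" for W P Q P' Q' :: complex
    proof -
      have "W * (s * P + Q) ^ N * (r * P' + Q') ^ N' = W * (\<Sum>i\<le>N. \<Sum>k\<le>N'.
          of_nat (N choose i) * s ^ i * (P ^ i * Q ^ (N - i)) * (of_nat (N' choose k) * r ^ k * (P' ^ k * Q' ^ (N' - k))))"
        unfolding binomial_expand mult.assoc[of W] by (subst sum_product) (rule refl)
      then show ?thesis by (simp add: sum_distrib_left mult_ac)
    qed
    have "(\<integral>\<zeta>. poisson_weight z \<zeta> * (s * p \<zeta> + q \<zeta>) ^ N * (r * cnj (p \<zeta>) + cnj (q \<zeta>)) ^ N' \<partial>sphere_measure)
        = (\<integral>\<zeta>. (\<Sum>i\<le>N. \<Sum>k\<le>N'. of_nat (N choose i) * of_nat (N' choose k) * s ^ i * r ^ k *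
            (poisson_weight z \<zeta> * p \<zeta> ^ i * cnj (p \<zeta>) ^ k * q \<zeta> ^ (N - i) * cnj (q \<zeta>) ^ (N' - k))) \<partial>sphere_measure)"
      by (simp only: expand)
    also have "\<dots> = (\<Sum>i\<le>N. \<Sum>k\<le>N'. of_nat (N choose i) * of_nat (N' choose k) * s ^ i * r ^ k * M i k)"
      unfolding M_def
      by (subst Bochner_Integration.integral_sum; (intro Bochner_Integration.integrable_sum integrable_mult_right int)?)
        (subst Bochner_Integration.integral_sum; (intro integrable_mult_right int)?; simp)
    finally show ?thesis
      \<comment> \<open>With both degrees fixed, the coefficients of q may be set to 1. The second
        pencil is conjugated, hence \<open>cnj r\<close>.\<close>
      using mobius_moments[OF z x y, of s 1 N "cnj r" 1 N']
      by (simp add: mobius_pencil_def pencil_gram_def p_def q_def A_def B_def B'_def D_def K_def)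
  qed
  define T where "T = (\<Sum>m\<le>k. (of_nat (i choose m) * A ^ m * B ^ (i - m)) *
      (of_nat ((N - i) choose (k - m)) * B' ^ (k - m) * D ^ (N - i - (k - m))))"
  have "of_nat (N' choose k) * M i k = (if N = N' then K * T else 0)"
    unfolding T_def by (rule polarized_coefficients[OF gen]) (simp_all add: N_def N'_def)
  moreover have "of_nat (N' choose k) = (fact N' / (fact k * fact d) :: complex)"
    by (simp add: binomial_fact N'_def)
  ultimately have "fact N' / (fact k * fact d) * M i k = (if N = N' then K * T else 0)" by simp
  then have "M i k = (if N = N' then of_real (sphere_area CARD('n)) * (fact k * fact d / pochhammer (of_nat CARD('n)) N) * T else 0)"
    using pochhammer_of_nat_neq_0[of "CARD('n)" N', where 'a=complex] by (simp add: K_def field_simps split: if_splits)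
  moreover have "N - i = b" "N' - k = d" by (simp_all add: N_def N'_def)
  ultimately show ?thesis unfolding M_def T_def by (simp only: N_def N'_def)
qed

subsection \<open>The M-harmonic Szego kernel\<close>

text \<open>The first numerator symbol is at most the denominator symbol, factor by factor, so the
  terms are dominated by the negative binomial series with parameter j + n.\<close>

lemma hyp2F1_sums:
  fixes x :: real
  assumes x: "0 \<le> x" "x < 1" and n: "0 < n"
  shows "(\<lambda>r. pochhammer (real (i + n)) r * pochhammer (real (j + n)) r / (pochhammer (real (h + i + j + n)) r * fact r) * x ^ r)
    sums hyp2F1 (real (i + n)) (real (j + n)) (real (h + i + j + n)) x"
proof -
  have "summable (\<lambda>r. pochhammer (real (i + n)) r * pochhammer (real (j + n)) r / (pochhammer (real (h + i + j + n)) r * fact r) * x ^ r)"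
  proof (rule summable_comparison_test)
    show "summable (\<lambda>r. neg_binomial_coeff (j + n) r * x ^ r)" by (rule summable_neg_binomial[OF x])
    have "norm (pochhammer (real (i + n)) r * pochhammer (real (j + n)) r / (pochhammer (real (h + i + j + n)) r * fact r) * x ^ r)
        \<le> neg_binomial_coeff (j + n) r * x ^ r" for r
    proof -
      have pos: "0 < pochhammer (real (i + n)) r" "0 < pochhammer (real (j + n)) r" "0 < pochhammer (real (h + i + j + n)) r"
        using n by (auto intro!: pochhammer_pos)
      have "pochhammer (real (i + n)) r \<le> pochhammer (real (h + i + j + n)) r"
        unfolding pochhammer_prod by (intro prod_mono) auto
      then have "pochhammer (real (i + n)) r / pochhammer (real (h + i + j + n)) r \<le> 1" using pos by simp
      then have "pochhammer (real (i + n)) r / pochhammer (real (h + i + j + n)) r * (neg_binomial_coeff (j + n) r * x ^ r)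
          \<le> 1 * (neg_binomial_coeff (j + n) r * x ^ r)"
        using pos x by (intro mult_right_mono) (auto simp: neg_binomial_coeff_def)
      then show ?thesis using pos x by (simp add: neg_binomial_coeff_def abs_mult)
    qed
    then show "\<exists>N. \<forall>r\<ge>N. norm (pochhammer (real (i + n)) r * pochhammer (real (j + n)) r / (pochhammer (real (h + i + j + n)) r * fact r) * x ^ r)
        \<le> neg_binomial_coeff (j + n) r * x ^ r" by blast
  qed
  then show ?thesis by (simp add: hyp2F1_def summable_sums)
qed

text \<open>The origin of the symbols (-n)_(i1 + i2) and (-n)_(i1 + j1): they come from the
  expansions of the two conjugate numerators.\<close>

lemma power_one_minus_expand:
  fixes u :: complex
  shows "(1 - u) ^ n = (\<Sum>i\<le>n. pochhammer (- of_nat n) i / fact i * u ^ i)"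
proof -
  have "(1 - u) ^ n = ((- u) + 1) ^ n" by simp
  also have "\<dots> = (\<Sum>i\<le>n. of_nat (n choose i) * (- u) ^ i)"
    by (subst binomial_ring) simp
  also have "\<dots> = (\<Sum>i\<le>n. pochhammer (- of_nat n) i / fact i * u ^ i)"
  proof (intro sum.cong refl)
    fix i
    have "of_nat (n choose i) = (-1) ^ i * pochhammer (- of_nat n :: complex) i / fact i"
      by (simp add: binomial_gbinomial gbinomial_pochhammer)
    then show "of_nat (n choose i) * (- u) ^ i = pochhammer (- of_nat n) i / fact i * u ^ i"
      by (simp add: power_minus[of u] mult_ac flip: power_add)
  qed
  finally show ?thesis .
qed

text \<open>Substitution i = m + b, k = m + a. The common part m becomes the exponent of t1, the
  excesses a and b those of t2 and t3.\<close>

lemma sum_triangle_reindex: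
  fixes X :: "nat \<Rightarrow> nat \<Rightarrow> nat \<Rightarrow> 'a :: comm_monoid_add"
  shows "(\<Sum>i\<le>n. \<Sum>k\<le>n. \<Sum>m\<le>min i k. X m (k - m) (i - m)) = (\<Sum>m=0..n. \<Sum>a=0..n - m. \<Sum>b=0..n - m. X m a b)"
proof -
  have "(\<Sum>i\<le>n. \<Sum>k\<le>n. \<Sum>m\<le>min i k. X m (k - m) (i - m))
      = (\<Sum>(i, k, m)\<in>(SIGMA i:{..n}. SIGMA k:{..n}. {..min i k}). X m (k - m) (i - m))"
    by (simp add: sum.Sigma)
  also have "\<dots> = (\<Sum>(m, a, b)\<in>(SIGMA m:{0..n}. SIGMA a:{0..n - m}. {0..n - m}). X m a b)"
    by (rule sum.reindex_bij_witness[where i="\<lambda>(m, a, b). (m + b, m + a, m)" and j="\<lambda>(i, k, m). (m, k - m, i - m)"]) auto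
  also have "\<dots> = (\<Sum>m=0..n. \<Sum>a=0..n - m. \<Sum>b=0..n - m. X m a b)"
    by (simp add: sum.Sigma)
  finally show ?thesis .
qed

text \<open>When the conjugate denominator is expanded first, balance of degrees keeps only d = i +
  b - k, leaving a single series in b. For each m it starts at b = k - m, and from there on its
  terms are a constant times those of a hypergeometric series in D.\<close>

lemma mobius_mixed_integral:
  fixes z x y :: "complex ^ 'n"
  assumes z: "norm z < 1" and x: "norm x < 1" and y: "norm y < 1"
  defines "n \<equiv> CARD('n)"
  defines "p \<equiv> mobius_cinner z x" and "q \<equiv> mobius_cinner z y"
  defines "A \<equiv> mobius_cinner z x x" and "B \<equiv> mobius_cinner z x y" and "B' \<equiv> mobius_cinner z y x" and "D \<equiv> Re (mobius_cinner z y y)"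
  shows "(\<integral>\<zeta>. poisson_weight z \<zeta> * p \<zeta> ^ i * cnj (p \<zeta>) ^ k * inverse (1 - q \<zeta>) ^ n * inverse (1 - cnj (q \<zeta>)) ^ n \<partial>sphere_measure)
    = of_real (sphere_area n) * (\<Sum>m\<le>min i k. fact i * fact k / (fact m * fact (i - m) * fact (k - m))
        * (pochhammer (of_nat n) (k - m) * pochhammer (of_nat n) (i - m) / pochhammer (of_nat n) (m + (k - m) + (i - m)))
        * A ^ m * B' ^ (k - m) * B ^ (i - m)
        * of_real (hyp2F1 (real (k - m + n)) (real (i - m + n)) (real (m + (k - m) + (i - m) + n)) D))"
proof -
  define S where "S = complex_of_real (sphere_area n)"
  have n: "0 < n" by (simp add: n_def)
  have [measurable]: "p \<in> borel_measurable borel" "q \<in> borel_measurable borel" by (simp_all add: p_def q_def)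
  have D: "0 \<le> D" "D < 1" using mobius_cinner_self_bounds[OF z y] by (simp_all add: D_def)
  have Dc: "mobius_cinner z y y = of_real D" by (simp add: D_def mobius_cinner_self)
  have p1: "norm (p \<zeta>) \<le> 1" and q1: "norm (q \<zeta>) \<le> 1" and qD: "norm (q \<zeta>) \<le> sqrt D" if "norm \<zeta> = 1" for \<zeta>
    using norm_mobius_cinner_le_1[OF z x that] norm_mobius_cinner_le_1[OF z y that] norm_mobius_cinner_le_sqrt[OF z y that]
    by (simp_all add: p_def q_def D_def)
  have sqrtD: "sqrt D < 1" using D by simp
  define C where "C = norm (1 - cinner z z) ^ CARD('n) * (inverse (1 - norm z) ^ CARD('n) * inverse (1 - norm z) ^ CARD('n))"
  have C: "norm (poisson_weight z \<zeta>) \<le> C" "0 \<le> C" if "norm \<zeta> = 1" for \<zeta>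
    using norm_poisson_weight_le[OF z that] z by (auto simp: C_def)
  have pk: "norm (poisson_weight z \<zeta> * p \<zeta> ^ i * cnj (p \<zeta>) ^ k) \<le> C" if "norm \<zeta> = 1" for \<zeta>
  proof -
    have "norm (poisson_weight z \<zeta> * p \<zeta> ^ i * cnj (p \<zeta>) ^ k) \<le> C * 1 * 1"
      unfolding norm_mult norm_power complex_mod_cnj
      using p1[OF that] C[OF that] by (intro mult_mono power_le_one mult_nonneg_nonneg zero_le_power norm_ge_zero) auto
    then show ?thesis by simp
  qed
  define J where "J = (\<integral>\<zeta>. poisson_weight z \<zeta> * p \<zeta> ^ i * cnj (p \<zeta>) ^ k * inverse (1 - q \<zeta>) ^ n * inverse (1 - cnj (q \<zeta>)) ^ n \<partial>sphere_measure)"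
  define T where "T b = (\<Sum>m\<le>k. (of_nat (i choose m) * A ^ m * B ^ (i - m)) *
      (of_nat (b choose (k - m)) * B' ^ (k - m) * of_real D ^ (b - (k - m))))" for b
  have inner: "(\<integral>\<zeta>. poisson_weight z \<zeta> * p \<zeta> ^ i * cnj (p \<zeta>) ^ k * q \<zeta> ^ b * inverse (1 - cnj (q \<zeta>)) ^ n \<partial>sphere_measure)
      = (if k \<le> i + b then neg_binomial_coeff n (i + b - k) * (S * (fact k * fact (i + b - k) / pochhammer (of_nat n) (i + b)) * T b) else 0)" for b
  proof -
    have "(\<lambda>d. neg_binomial_coeff n d * (\<integral>\<zeta>. poisson_weight z \<zeta> * p \<zeta> ^ i * cnj (p \<zeta>) ^ k * q \<zeta> ^ b * cnj (q \<zeta>) ^ d \<partial>sphere_measure))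
      sums (\<integral>\<zeta>. poisson_weight z \<zeta> * p \<zeta> ^ i * cnj (p \<zeta>) ^ k * q \<zeta> ^ b * inverse (1 - cnj (q \<zeta>)) ^ n \<partial>sphere_measure)"
    proof (rule sphere_integral_neg_binomial[where r="sqrt D" and C="C * 1"])
      fix \<zeta> :: "complex ^ 'n" assume \<zeta>: "norm \<zeta> = 1"
      show "norm (cnj (q \<zeta>)) \<le> sqrt D" using qD[OF \<zeta>] by simp
      show "norm (poisson_weight z \<zeta> * p \<zeta> ^ i * cnj (p \<zeta>) ^ k * q \<zeta> ^ b) \<le> C * 1"
        unfolding norm_mult[of _ "q \<zeta> ^ b"] norm_power[of "q \<zeta>"] using pk[OF \<zeta>] q1[OF \<zeta>] C(2)[OF \<zeta>]
        by (intro mult_mono power_le_one) auto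
    qed (use sqrtD in simp_all)
    moreover have "(\<lambda>d. neg_binomial_coeff n d * (\<integral>\<zeta>. poisson_weight z \<zeta> * p \<zeta> ^ i * cnj (p \<zeta>) ^ k * q \<zeta> ^ b * cnj (q \<zeta>) ^ d \<partial>sphere_measure))
      = (\<lambda>d. if i + b = k + d then neg_binomial_coeff n d * (S * (fact k * fact d / pochhammer (of_nat n) (i + b)) * T b) else 0)"
      using mobius_monomial_moments[OF z x y, of i k b] unfolding p_def q_def T_def S_def A_def B_def B'_def Dc n_def by (auto simp: fun_eq_iff)
    \<comment> \<open>Subtraction truncates at 0, so i + b - k is a genuine solution for d only
      under the guard k \<le> i + b.\<close>
    moreover have "\<dots> = (\<lambda>d. if d = i + b - k then (if k \<le> i + b then neg_binomial_coeff n (i + b - k) * (S * (fact k * fact (i + b - k) / pochhammer (of_nat n) (i + b)) * T b) else 0) else 0)"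
      by (rule ext) auto
    ultimately show ?thesis
      using sums_unique2[OF _ sums_single[of "i + b - k" "\<lambda>_. if k \<le> i + b then neg_binomial_coeff n (i + b - k) * (S * (fact k * fact (i + b - k) / pochhammer (of_nat n) (i + b)) * T b) else 0"]]
      by simp
  qed
  have outer: "(\<lambda>b. neg_binomial_coeff n b * (if k \<le> i + b then neg_binomial_coeff n (i + b - k) * (S * (fact k * fact (i + b - k) / pochhammer (of_nat n) (i + b)) * T b) else 0)) sums J"
  proof -
    have "(\<lambda>b. neg_binomial_coeff n b * (\<integral>\<zeta>. poisson_weight z \<zeta> * p \<zeta> ^ i * cnj (p \<zeta>) ^ k * inverse (1 - cnj (q \<zeta>)) ^ n * q \<zeta> ^ b \<partial>sphere_measure))
      sums (\<integral>\<zeta>. poisson_weight z \<zeta> * p \<zeta> ^ i * cnj (p \<zeta>) ^ k * inverse (1 - cnj (q \<zeta>)) ^ n * inverse (1 - q \<zeta>) ^ n \<partial>sphere_measure)"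
    proof (rule sphere_integral_neg_binomial[where r="sqrt D" and C="C * inverse (1 - sqrt D) ^ n"])
      fix \<zeta> :: "complex ^ 'n" assume \<zeta>: "norm \<zeta> = 1"
      show "norm (q \<zeta>) \<le> sqrt D" using qD[OF \<zeta>] .
      show "norm (poisson_weight z \<zeta> * p \<zeta> ^ i * cnj (p \<zeta>) ^ k * inverse (1 - cnj (q \<zeta>)) ^ n) \<le> C * inverse (1 - sqrt D) ^ n"
        unfolding norm_mult[of _ "inverse (1 - cnj (q \<zeta>)) ^ n"] using pk[OF \<zeta>] qD[OF \<zeta>] C(2)[OF \<zeta>] sqrtD
        by (intro mult_mono norm_inverse_one_minus_le) auto
    qed (use sqrtD in simp_all)
    then show ?thesis unfolding J_def inner[symmetric] by (simp add: mult_ac)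
  qed
  define c where "c m = (fact i * fact k / (fact m * fact (i - m) * fact (k - m)) * A ^ m * B' ^ (k - m) * B ^ (i - m) :: complex)" for m
  \<comment> \<open>The guard marks where the binomial b choose (k - m) vanishes. If k > i + b it
    fails for every m \<le> min i k, so the guard of the outer series is absorbed as well.\<close>
  define \<tau> where "\<tau> m b = (if k - m \<le> b then c m * (pochhammer (of_nat n) b * pochhammer (of_nat n) (i + b - k)
      / (pochhammer (of_nat n) (i + b) * fact (b - (k - m)))) * of_real D ^ (b - (k - m)) else 0)" for m b
  have term_eq: "neg_binomial_coeff n b * (if k \<le> i + b then neg_binomial_coeff n (i + b - k) * (S * (fact k * fact (i + b - k) / pochhammer (of_nat n) (i + b)) * T b) else 0)
      = S * (\<Sum>m\<le>min i k. \<tau> m b)" for b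
  proof (cases "k \<le> i + b")
    case False
    then have "\<tau> m b = 0" if "m \<le> min i k" for m using that by (auto simp: \<tau>_def)
    with False show ?thesis by simp
  next
    case True
    define e where "e m = (of_nat (i choose m) * A ^ m * B ^ (i - m)) * (of_nat (b choose (k - m)) * B' ^ (k - m) * of_real D ^ (b - (k - m)))" for m
    define f where "f = (neg_binomial_coeff n b * neg_binomial_coeff n (i + b - k) * (fact k * fact (i + b - k) / pochhammer (of_nat n) (i + b)) :: complex)"
    have "T b = (\<Sum>m\<le>min i k. e m)"
      unfolding T_def e_def[symmetric] by (rule sum.mono_neutral_right) (auto simp: e_def)
    moreover have "f * e m = \<tau> m b" if "m \<le> min i k" for m
    proof (cases "k - m \<le> b")
      case False
      then show ?thesis by (simp add: e_def \<tau>_def)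
    next
      case le: True
      have "of_nat (i choose m) = (fact i / (fact m * fact (i - m)) :: complex)"
        using that by (intro binomial_fact) simp
      moreover have "of_nat (b choose (k - m)) = (fact b / (fact (k - m) * fact (b - (k - m))) :: complex)"
        using le by (rule binomial_fact)
      ultimately show ?thesis
        using le by (simp add: f_def e_def \<tau>_def c_def neg_binomial_coeff_def mult_ac)
    qed
    ultimately have "f * T b = (\<Sum>m\<le>min i k. \<tau> m b)" by (simp add: sum_distrib_left)
    then have "S * (f * T b) = S * (\<Sum>m\<le>min i k. \<tau> m b)" by simp
    with True show ?thesis by (simp add: f_def mult_ac)
  qed
  have "(\<lambda>b. \<tau> m b) sums (c m * (pochhammer (of_nat n) (k - m) * pochhammer (of_nat n) (i - m) / pochhammer (of_nat n) (m + (k - m) + (i - m)))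
      * of_real (hyp2F1 (real (k - m + n)) (real (i - m + n)) (real (m + (k - m) + (i - m) + n)) D))" if m: "m \<le> min i k" for m
  proof -
    let ?h = "\<lambda>r. pochhammer (real (k - m + n)) r * pochhammer (real (i - m + n)) r / (pochhammer (real (m + (k - m) + (i - m) + n)) r * fact r) * D ^ r"
    have "(\<lambda>r. (c m * (pochhammer (of_nat n) (k - m) * pochhammer (of_nat n) (i - m) / pochhammer (of_nat n) (m + (k - m) + (i - m)))) * of_real (?h r))
      sums ((c m * (pochhammer (of_nat n) (k - m) * pochhammer (of_nat n) (i - m) / pochhammer (of_nat n) (m + (k - m) + (i - m))))
       * of_real (hyp2F1 (real (k - m + n)) (real (i - m + n)) (real (m + (k - m) + (i - m) + n)) D))"
      by (intro sums_mult sums_of_real hyp2F1_sums D n)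
    also have "(\<lambda>r. (c m * (pochhammer (of_nat n) (k - m) * pochhammer (of_nat n) (i - m) / pochhammer (of_nat n) (m + (k - m) + (i - m)))) * of_real (?h r))
       = (\<lambda>r. \<tau> m (r + (k - m)))"
    proof
      fix r
      \<comment> \<open>The splitting (n)_(a + r) = (n)_a (n + a)_r separates the constant prefactor
        from the hypergeometric term.\<close>
      have prod: "pochhammer (of_nat n) a * of_real (pochhammer (real (a + n)) r) = (pochhammer (of_nat n) (a + r) :: complex)" for a
        using pochhammer_product'[of "of_nat n :: complex" a r] by (simp add: pochhammer_of_real[symmetric] add.commute)
      have idx: "i + (r + (k - m)) - k = (i - m) + r" "i + (r + (k - m)) = m + (k - m) + (i - m) + r" "r + (k - m) - (k - m) = r"
        using m by auto
      show "(c m * (pochhammer (of_nat n) (k - m) * pochhammer (of_nat n) (i - m) / pochhammer (of_nat n) (m + (k - m) + (i - m)))) * of_real (?h r)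
          = \<tau> m (r + (k - m))"
        unfolding \<tau>_def idx(1) unfolding idx(2,3) unfolding add.commute[of r "k - m"] prod[symmetric] by (simp add: mult_ac)
    qed
    finally have "(\<lambda>r. \<tau> m (r + (k - m))) sums (c m * (pochhammer (of_nat n) (k - m) * pochhammer (of_nat n) (i - m) / pochhammer (of_nat n) (m + (k - m) + (i - m)))
      * of_real (hyp2F1 (real (k - m + n)) (real (i - m + n)) (real (m + (k - m) + (i - m) + n)) D))" .
    moreover have "(\<Sum>b<k - m. \<tau> m b) = 0" by (rule sum.neutral) (auto simp: \<tau>_def)
    ultimately show ?thesis by (simp add: sums_iff_shift)
  qed
  then have "(\<lambda>b. S * (\<Sum>m\<le>min i k. \<tau> m b)) sums (S * (\<Sum>m\<le>min i k. c m * (pochhammer (of_nat n) (k - m) * pochhammer (of_nat n) (i - m) / pochhammer (of_nat n) (m + (k - m) + (i - m)))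
      * of_real (hyp2F1 (real (k - m + n)) (real (i - m + n)) (real (m + (k - m) + (i - m) + n)) D)))"
    by (intro sums_mult sums_sum) auto
  with outer have "J = S * (\<Sum>m\<le>min i k. c m * (pochhammer (of_nat n) (k - m) * pochhammer (of_nat n) (i - m) / pochhammer (of_nat n) (m + (k - m) + (i - m)))
      * of_real (hyp2F1 (real (k - m + n)) (real (i - m + n)) (real (m + (k - m) + (i - m) + n)) D))"
    unfolding term_eq by (rule sums_unique2)
  then show ?thesis unfolding J_def S_def c_def by (simp add: mult_ac)
qed

lemma mobius_sphere_integral:
  fixes z x y :: "complex ^ 'n"
  assumes z: "norm z < 1" and x: "norm x < 1" and y: "norm y < 1"
  defines "n \<equiv> CARD('n)"
  defines "p \<equiv> mobius_cinner z x" and "q \<equiv> mobius_cinner z y"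
  defines "A \<equiv> mobius_cinner z x x" and "B \<equiv> mobius_cinner z x y" and "B' \<equiv> mobius_cinner z y x" and "D \<equiv> Re (mobius_cinner z y y)"
  shows "(\<integral>\<zeta>. poisson_weight z \<zeta> * (1 - p \<zeta>) ^ n * (1 - cnj (p \<zeta>)) ^ n * inverse (1 - q \<zeta>) ^ n * inverse (1 - cnj (q \<zeta>)) ^ n \<partial>sphere_measure)
    = of_real (sphere_area n) * (\<Sum>i1 = 0..n. \<Sum>i2 = 0..n - i1. \<Sum>j1 = 0..n - i1.
       pochhammer (- of_nat n) (i1 + i2) * pochhammer (- of_nat n) (i1 + j1)
         * pochhammer (of_nat n) i2 * pochhammer (of_nat n) j1
         / (fact i1 * fact i2 * fact j1 * pochhammer (of_nat n) (i1 + i2 + j1))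
       * A ^ i1 * B' ^ i2 * B ^ j1
       * complex_of_real (hyp2F1 (real (i2 + n)) (real (j1 + n)) (real (i1 + i2 + j1 + n)) D))"
proof -
  define e where "e i = (pochhammer (- of_nat n) i / fact i :: complex)" for i
  define X where "X i1 i2 j1 = (pochhammer (- of_nat n) (i1 + i2) * pochhammer (- of_nat n) (i1 + j1)
         * pochhammer (of_nat n) i2 * pochhammer (of_nat n) j1
         / (fact i1 * fact i2 * fact j1 * pochhammer (of_nat n) (i1 + i2 + j1))
       * A ^ i1 * B' ^ i2 * B ^ j1
       * complex_of_real (hyp2F1 (real (i2 + n)) (real (j1 + n)) (real (i1 + i2 + j1 + n)) D))" for i1 i2 j1
  define f where "f i k \<zeta> = poisson_weight z \<zeta> * p \<zeta> ^ i * cnj (p \<zeta>) ^ k * inverse (1 - q \<zeta>) ^ n * inverse (1 - cnj (q \<zeta>)) ^ n" for i k \<zeta>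
  have [measurable]: "p \<in> borel_measurable borel" "q \<in> borel_measurable borel" by (simp_all add: p_def q_def)
  have sqrtD: "sqrt D < 1" using mobius_cinner_self_bounds[OF z y] by (simp add: D_def)
  define C where "C = norm (1 - cinner z z) ^ CARD('n) * (inverse (1 - norm z) ^ CARD('n) * inverse (1 - norm z) ^ CARD('n))"
  have int: "integrable sphere_measure (f i k)" for i k
  proof (rule integrable_sphere_bounded[where C="C * 1 * 1 * inverse (1 - sqrt D) ^ n * inverse (1 - sqrt D) ^ n"])
    fix \<zeta> :: "complex ^ 'n" assume \<zeta>: "norm \<zeta> = 1"
    have "norm (p \<zeta>) \<le> 1" "norm (q \<zeta>) \<le> sqrt D"
      using norm_mobius_cinner_le_1[OF z x \<zeta>] norm_mobius_cinner_le_sqrt[OF z y \<zeta>] by (simp_all add: p_def q_def D_def)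
    then show "norm (f i k \<zeta>) \<le> C * 1 * 1 * inverse (1 - sqrt D) ^ n * inverse (1 - sqrt D) ^ n"
      unfolding f_def norm_mult using norm_poisson_weight_le[OF z \<zeta>] sqrtD z
      by (intro mult_mono norm_inverse_one_minus_le mult_nonneg_nonneg) (auto simp: C_def norm_power intro!: power_le_one)
  qed (unfold f_def, measurable)
  have "(\<integral>\<zeta>. poisson_weight z \<zeta> * (1 - p \<zeta>) ^ n * (1 - cnj (p \<zeta>)) ^ n * inverse (1 - q \<zeta>) ^ n * inverse (1 - cnj (q \<zeta>)) ^ n \<partial>sphere_measure)
      = (\<integral>\<zeta>. (\<Sum>i\<le>n. \<Sum>k\<le>n. e i * e k * f i k \<zeta>) \<partial>sphere_measure)"
  proof (rule Bochner_Integration.integral_cong[OF refl])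
    fix \<zeta>
    have "poisson_weight z \<zeta> * (1 - p \<zeta>) ^ n * (1 - cnj (p \<zeta>)) ^ n * inverse (1 - q \<zeta>) ^ n * inverse (1 - cnj (q \<zeta>)) ^ n
        = (poisson_weight z \<zeta> * inverse (1 - q \<zeta>) ^ n * inverse (1 - cnj (q \<zeta>)) ^ n) * ((1 - p \<zeta>) ^ n * (1 - cnj (p \<zeta>)) ^ n)"
      by (simp add: mult_ac)
    also have "(1 - p \<zeta>) ^ n * (1 - cnj (p \<zeta>)) ^ n = (\<Sum>i\<le>n. \<Sum>k\<le>n. (e i * p \<zeta> ^ i) * (e k * cnj (p \<zeta>) ^ k))"
      unfolding power_one_minus_expand e_def by (rule sum_product)
    finally show "poisson_weight z \<zeta> * (1 - p \<zeta>) ^ n * (1 - cnj (p \<zeta>)) ^ n * inverse (1 - q \<zeta>) ^ n * inverse (1 - cnj (q \<zeta>)) ^ n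
        = (\<Sum>i\<le>n. \<Sum>k\<le>n. e i * e k * f i k \<zeta>)"
      by (simp add: f_def sum_distrib_left mult_ac)
  qed
  also have "\<dots> = (\<Sum>i\<le>n. \<Sum>k\<le>n. e i * e k * (\<integral>\<zeta>. f i k \<zeta> \<partial>sphere_measure))"
    by (simp add: int)
  also have "\<dots> = (\<Sum>i\<le>n. \<Sum>k\<le>n. \<Sum>m\<le>min i k. of_real (sphere_area n) * X m (k - m) (i - m))"
  proof (intro sum.cong refl)
    fix i k
    have J: "(\<integral>\<zeta>. f i k \<zeta> \<partial>sphere_measure) = of_real (sphere_area n) * (\<Sum>m\<le>min i k. fact i * fact k / (fact m * fact (i - m) * fact (k - m))
        * (pochhammer (of_nat n) (k - m) * pochhammer (of_nat n) (i - m) / pochhammer (of_nat n) (m + (k - m) + (i - m)))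
        * A ^ m * B' ^ (k - m) * B ^ (i - m)
        * of_real (hyp2F1 (real (k - m + n)) (real (i - m + n)) (real (m + (k - m) + (i - m) + n)) D))"
      unfolding f_def using mobius_mixed_integral[OF z x y, of i k]
      unfolding p_def q_def n_def A_def B_def B'_def D_def .
    show "e i * e k * (\<integral>\<zeta>. f i k \<zeta> \<partial>sphere_measure) = (\<Sum>m\<le>min i k. of_real (sphere_area n) * X m (k - m) (i - m))"
      unfolding J sum_distrib_left
    proof (intro sum.cong refl)
      fix m assume "m \<in> {..min i k}"
      then have "m + (k - m) = k" "m + (i - m) = i" by auto
      \<comment> \<open>The factorials of i and k cancel against the denominators of
        \<open>e i\<close> and \<open>e k\<close>.\<close>
      then show "e i * e k * (of_real (sphere_area n) * (fact i * fact k / (fact m * fact (i - m) * fact (k - m))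
        * (pochhammer (of_nat n) (k - m) * pochhammer (of_nat n) (i - m) / pochhammer (of_nat n) (m + (k - m) + (i - m)))
        * A ^ m * B' ^ (k - m) * B ^ (i - m)
        * of_real (hyp2F1 (real (k - m + n)) (real (i - m + n)) (real (m + (k - m) + (i - m) + n)) D)))
        = of_real (sphere_area n) * X m (k - m) (i - m)"
        unfolding X_def e_def by (simp add: mult_ac)
    qed
  qed
  also have "\<dots> = (\<Sum>m=0..n. \<Sum>a=0..n - m. \<Sum>b=0..n - m. of_real (sphere_area n) * X m a b)"
    by (rule sum_triangle_reindex[of "\<lambda>m a b. of_real (sphere_area n) * X m a b"])
  finally show ?thesis unfolding X_def sum_distrib_left .
qed

section \<open>The kernel as a transformed integral\<close>

lemma of_real_norm_power_twice: "complex_of_real (norm u ^ (2 * n)) = (u * cnj u) ^ n"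
  by (simp only: power_mult of_real_power complex_norm_square[symmetric])

theorem theorem3p3:
  fixes z w :: "complex ^ 'n"
  assumes "z \<in> ball 0 1" and "w \<in> ball 0 1"
  defines "n \<equiv> CARD('n)"
  defines "t1 \<equiv> complex_of_real (norm z ^ 2)"
  defines "t2 \<equiv> (complex_of_real (norm z ^ 2) - cinner w z) / (1 - cinner w z)"
  defines "t3 \<equiv> cnj t2"
  defines "t4 \<equiv> 1 - (1 - norm z ^ 2) * (1 - norm w ^ 2) / cmod (1 - cinner z w) ^ 2"
  shows "complex_of_real (K_Sz z w) =
    complex_of_real (Gamma (real n) / (2 * pi ^ n) *
      (1 - norm w ^ 2) ^ n / cmod (1 - cinner z w) ^ (2 * n)) *
    (\<Sum>i1 = 0..n. \<Sum>i2 = 0..n - i1. \<Sum>j1 = 0..n - i1.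
       pochhammer (- of_nat n) (i1 + i2) * pochhammer (- of_nat n) (i1 + j1)
         * pochhammer (of_nat n) i2 * pochhammer (of_nat n) j1
         / (fact i1 * fact i2 * fact j1 * pochhammer (of_nat n) (i1 + i2 + j1))
       * t1 ^ i1 * t2 ^ i2 * t3 ^ j1
       * complex_of_real (hyp2F1 (real (i2 + n)) (real (j1 + n)) (real (i1 + i2 + j1 + n)) t4))"
proof -
  have z: "norm z < 1" and w: "norm w < 1" using assms(1,2) by auto
  have n: "0 < n" by (simp add: n_def)
  define g where "g = Gamma (real n) / (2 * pi ^ n)"
  have nonpos: "real n \<notin> \<int>\<^sub>\<le>\<^sub>0" using n nonpos_Ints_nonpos[of "real n"] by auto
  have g_area: "g * sphere_area n = 1"
    using nonpos by (simp add: g_def sphere_area_def Gamma_eq_zero_iff)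
  define Z W where "Z = 1 - (norm z)\<^sup>2" and "W = 1 - (norm w)\<^sup>2"
  define a where "a = 1 - cinner w z"
  have a: "a \<noteq> 0" using cinner_neq_1[of w z] w z by (simp add: a_def)
  have norm_a: "norm (1 - cinner z w) = norm a"
    unfolding a_def using complex_mod_cnj[of "1 - cinner w z"] by (simp add: cnj_cinner)
  have Zc: "1 - cinner z z = of_real Z" by (simp add: Z_def cinner_self)
  have Z: "Z \<noteq> 0" using z power_less_one_iff[of "norm z" 2] by (simp add: Z_def)
  have zero: "cinner 0 u = 0" "cinner u 0 = 0" for u :: "complex ^ 'n" by (simp_all add: cinner_def)
  have t1: "mobius_cinner z 0 0 = t1" by (simp add: mobius_cinner_def zero t1_def cinner_self)
  have t2: "mobius_cinner z w 0 = t2"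
    using a by (simp add: mobius_cinner_def zero t2_def cinner_self a_def field_simps)
  have t3: "mobius_cinner z 0 w = t3"
    unfolding t3_def t2[symmetric] by (simp add: cnj_mobius_cinner)
  have t4: "Re (mobius_cinner z w w) = t4" by (simp add: mobius_cinner_self t4_def)
  define F where "F \<zeta> = poisson_weight z \<zeta> * (1 - mobius_cinner z 0 \<zeta>) ^ n * (1 - cnj (mobius_cinner z 0 \<zeta>)) ^ n
      * inverse (1 - mobius_cinner z w \<zeta>) ^ n * inverse (1 - cnj (mobius_cinner z w \<zeta>)) ^ n" for \<zeta>
  have "complex_of_real (K_Sz z w) = (\<integral>\<zeta>. complex_of_real (poisson_ball z \<zeta> * poisson_ball w \<zeta>) \<partial>sphere_measure)"
    unfolding K_Sz_def by (rule integral_complex_of_real[symmetric])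
  also have "\<dots> = (\<integral>\<zeta>. of_real (g * g * W ^ n / norm a ^ (2 * n)) * F \<zeta> \<partial>sphere_measure)"
  proof (rule integral_cong_AE)
    show "AE \<zeta> in sphere_measure. complex_of_real (poisson_ball z \<zeta> * poisson_ball w \<zeta>) = of_real (g * g * W ^ n / norm a ^ (2 * n)) * F \<zeta>"
      using AE_sphere_measure
    proof eventually_elim
      case (elim \<zeta>)
      define b e where "b = 1 - cinner z \<zeta>" and "e = 1 - cinner w \<zeta>"
      have be: "b \<noteq> 0" "e \<noteq> 0" using cinner_neq_1[of z \<zeta>] cinner_neq_1[of w \<zeta>] z w elim by (auto simp: b_def e_def)
      have cb: "1 - cinner \<zeta> z = cnj b" by (simp add: b_def cnj_cinner)
      have p: "1 - mobius_cinner z 0 \<zeta> = of_real Z / b" by (simp add: mobius_cinner_def zero Zc b_def)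
      have q: "1 - mobius_cinner z w \<zeta> = of_real Z * e / (a * b)" by (simp add: mobius_cinner_def Zc a_def b_def e_def)
      have cp: "1 - cnj (mobius_cinner z 0 \<zeta>) = cnj (of_real Z / b)" unfolding p[symmetric] by simp
      have cq: "1 - cnj (mobius_cinner z w \<zeta>) = cnj (of_real Z * e / (a * b))" unfolding q[symmetric] by simp
      \<comment> \<open>In the quotient of the factors 1 - <\<phi>(0),\<phi>(\<zeta>)> and 1 -
        <\<phi>(w),\<phi>(\<zeta>)> both Z and b cancel, leaving a / e; the Z and the modulus of b
        that survive come from the weight.\<close>
      have F: "F \<zeta> = (of_real Z * (a * cnj a) / ((b * cnj b) * (e * cnj e))) ^ n"
        unfolding F_def p q cp cq poisson_weight_def n_def[symmetric] Zc cb b_def[symmetric] power_mult_distrib[symmetric]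
        using be a Z by (intro arg_cong[where f="\<lambda>u. u ^ n"]) (simp add: field_simps)
      have "of_real (g * g * W ^ n / norm a ^ (2 * n)) * F \<zeta>
          = of_real (g * g) * (of_real W / (a * cnj a) * (of_real Z * (a * cnj a) / ((b * cnj b) * (e * cnj e)))) ^ n"
        unfolding F of_real_divide of_real_norm_power_twice by (simp add: power_mult_distrib power_divide)
      also have "of_real W / (a * cnj a) * (of_real Z * (a * cnj a) / ((b * cnj b) * (e * cnj e))) = of_real Z / (b * cnj b) * (of_real W / (e * cnj e))"
        using a by simp
      also have "of_real (g * g) * (of_real Z / (b * cnj b) * (of_real W / (e * cnj e))) ^ n = complex_of_real (poisson_ball z \<zeta> * poisson_ball w \<zeta>)"
        unfolding poisson_ball_def n_def[symmetric] g_def[symmetric] b_def[symmetric] e_def[symmetric] Z_def[symmetric] W_def[symmetric]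
          of_real_mult of_real_divide of_real_norm_power_twice by (simp add: power_mult_distrib power_divide)
      finally show ?case by (rule sym)
    qed
  qed (unfold F_def poisson_ball_def, measurable)
  also have "\<dots> = of_real (g * g * W ^ n / norm a ^ (2 * n)) * (\<integral>\<zeta>. F \<zeta> \<partial>sphere_measure)"
    by (rule integral_mult_right_zero)
  also have "(\<integral>\<zeta>. F \<zeta> \<partial>sphere_measure) = of_real (sphere_area n) * (\<Sum>i1 = 0..n. \<Sum>i2 = 0..n - i1. \<Sum>j1 = 0..n - i1.
       pochhammer (- of_nat n) (i1 + i2) * pochhammer (- of_nat n) (i1 + j1)
         * pochhammer (of_nat n) i2 * pochhammer (of_nat n) j1
         / (fact i1 * fact i2 * fact j1 * pochhammer (of_nat n) (i1 + i2 + j1))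
       * t1 ^ i1 * t2 ^ i2 * t3 ^ j1
       * complex_of_real (hyp2F1 (real (i2 + n)) (real (j1 + n)) (real (i1 + i2 + j1 + n)) t4))"
    using mobius_sphere_integral[OF z _ w, of 0] unfolding F_def n_def t1 t2 t3 t4 by simp
  \<comment> \<open>Each Poisson kernel contributes the reciprocal \<open>g\<close> of the total
    area; the integral over the sphere cancels one of the two.\<close>
  also have "of_real (g * g * W ^ n / norm a ^ (2 * n)) * (of_real (sphere_area n) * Q)
      = of_real (g * W ^ n / norm a ^ (2 * n)) * Q" for Q :: complex
  proof -
    have "g * g * W ^ n / norm a ^ (2 * n) * sphere_area n = (g * sphere_area n) * (g * W ^ n / norm a ^ (2 * n))" by simp
    also have "\<dots> = g * W ^ n / norm a ^ (2 * n)" unfolding g_area by simp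
    finally show ?thesis by (metis mult.assoc of_real_mult)
  qed
  finally show ?thesis unfolding g_def W_def norm_a .
qed

end
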